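(* Let $F$ be a field, let $D$ be a division algebra with center $F$ and degree $d>2$, let $K|F$ be any splitting field of $D$, and regard $D$ as an $F$-subalgebra of $M_d(K)$ via a splitting representation, so that $D^\times\le \mathrm{GL}_d(K)$. Let $N\le \mathrm{GL}_d(K)$ be the subgroup of monomial matrices and $T\le N$ the subgroup of invertible diagonal matrices, and identify $N/T$ with the symmetric group $S_d$. Let $X$ be any coset in $N/T$ whose cycle decomposition features a $k$-cycle with $d/2<k<d$. Let $z\in D^\times$ and $g\in\mathrm{GL}_d(K)$. Then $gzg^{-1}\notin X$.
   Context: A division algebra $D$ with center $F$ has degree $d$ if $\dim_F(D)=d^2$. A splitting field of $D$ is a field extension $K|F$ with $D\otimes_F K\cong M_d(K)$; a splitting representation is the resulting injective $F$-algebra homomorphism $D\hookrightarrow D\otimes_F K\cong M_d(K)$. A monomial matrix is one with exactly one nonzero entry in each row and column; the coset $nT$ of a monomial matrix $n$ corresponds to the permutation of $\{1,\dots,d\}$ given by the positions of the nonzero entries of $n$, which gives the identification $N/T\cong S_d$. *)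

theory Defs
  imports
    "HOL-Library.Poly_Mapping"
    "HOL-Combinatorics.Cycles"
    "HOL-Algebra.QuotRing"
    "HOL-Algebra.Coset"
    "Jordan_Normal_Form.Matrix"
begin

section \<open>Central division algebras\<close>

text \<open>A base field is a type \<open>'f\<close>, and an algebra or field extension over it is given by its
  structure map \<open>\<iota>\<close>.\<close>

definition division_algebra_with_center :: "('f::field \<Rightarrow> 'd::division_ring) \<Rightarrow> bool" where
  "division_algebra_with_center \<iota> \<longleftrightarrow>
     Ring_Hom.ring_hom \<iota> \<and> range \<iota> = {z. \<forall>x. z * x = x * z}"

text \<open>The dimension of an infinite-dimensional space is 0 in the library, so for \<open>d > 0\<close>
  this entails finite dimension.\<close>

definition has_degree :: "('f::field \<Rightarrow> 'd::division_ring) \<Rightarrow> nat \<Rightarrow> bool" where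
  "has_degree \<iota> d \<longleftrightarrow> vector_space.dim (\<lambda>a x. \<iota> a * x) UNIV = d\<^sup>2"

section \<open>The tensor product of two algebras\<close>

text \<open>\<open>A \<otimes>\<^sub>F B\<close> is the monoid ring of the multiplicative monoid \<open>A \<times> B\<close> with integer
  coefficients (additively: the free abelian group on \<open>A \<times> B\<close>), modulo the ideal generated by
  the bilinearity relations. The library turns finitely supported functions into a monoid ring
  only over an additively written monoid, so the multiplicative monoid \<open>A \<times> B\<close> is copied to a
  type on which \<open>+\<close> stands for componentwise multiplication.\<close>

datatype ('a, 'b) tensor_sym = Sym 'a 'b

instantiation tensor_sym :: (monoid_mult, monoid_mult) monoid_add
begin

definition zero_tensor_sym :: "('a, 'b) tensor_sym" where
  "zero_tensor_sym = Sym 1 1"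

fun plus_tensor_sym :: "('a, 'b) tensor_sym \<Rightarrow> ('a, 'b) tensor_sym \<Rightarrow> ('a, 'b) tensor_sym" where
  "plus_tensor_sym (Sym a b) (Sym a' b') = Sym (a * a') (b * b')"

instance
proof
  fix x y z :: "('a, 'b) tensor_sym"
  show "x + y + z = x + (y + z)"
    by (cases x; cases y; cases z) (simp add: mult.assoc)
  show "0 + x = x" "x + 0 = x"
    by (cases x; simp add: zero_tensor_sym_def)+
qed

end

type_synonym ('a, 'b) tensor_word = "('a, 'b) tensor_sym \<Rightarrow>\<^sub>0 int"

abbreviation word :: "'a::monoid_mult \<Rightarrow> 'b::monoid_mult \<Rightarrow> ('a, 'b) tensor_word" where
  "word a b \<equiv> Poly_Mapping.single (Sym a b) 1"

definition word_ring :: "('a::monoid_mult, 'b::monoid_mult) tensor_word ring" where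
  "word_ring = \<lparr>carrier = UNIV, mult = (*), one = 1, zero = 0, add = (+)\<rparr>"

lemma word_ring_ring: "ring (word_ring :: ('a::monoid_mult, 'b::monoid_mult) tensor_word ring)"
  by (rule ringI;
      auto simp: word_ring_def algebra_simps add_eq_0_iff2 intro!: abelian_groupI monoid.intro;
      metis minus_minus)

lemma word_mult: "word a b * word a' b' = word (a * a') (b * b')"
  by (simp add: mult_single)

definition tensor_relations ::
    "('f::field \<Rightarrow> 'a::ring_1) \<Rightarrow> ('f \<Rightarrow> 'b::ring_1) \<Rightarrow> ('a, 'b) tensor_word set" where
  "tensor_relations \<iota>\<^sub>A \<iota>\<^sub>B =
     {word (a + a') b - word a b - word a' b | a a' b. True} \<union>
     {word a (b + b') - word a b - word a b' | a b b'. True} \<union>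
     {word (\<iota>\<^sub>A t * a) b - word a (\<iota>\<^sub>B t * b) | t a b. True}"

definition tensor_ideal ::
    "('f::field \<Rightarrow> 'a::ring_1) \<Rightarrow> ('f \<Rightarrow> 'b::ring_1) \<Rightarrow> ('a, 'b) tensor_word set" where
  "tensor_ideal \<iota>\<^sub>A \<iota>\<^sub>B = genideal word_ring (tensor_relations \<iota>\<^sub>A \<iota>\<^sub>B)"

definition tensor_ring ::
    "('f::field \<Rightarrow> 'a::ring_1) \<Rightarrow> ('f \<Rightarrow> 'b::ring_1) \<Rightarrow> ('a, 'b) tensor_word set ring" where
  "tensor_ring \<iota>\<^sub>A \<iota>\<^sub>B = word_ring Quot tensor_ideal \<iota>\<^sub>A \<iota>\<^sub>B"

definition pure_tensor ::
    "('f::field \<Rightarrow> 'a::ring_1) \<Rightarrow> ('f \<Rightarrow> 'b::ring_1) \<Rightarrow> 'a \<Rightarrow> 'b \<Rightarrow> ('a, 'b) tensor_word set" where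
  "pure_tensor \<iota>\<^sub>A \<iota>\<^sub>B a b = tensor_ideal \<iota>\<^sub>A \<iota>\<^sub>B +>\<^bsub>word_ring\<^esub> word a b"

section \<open>Splitting fields and splitting representations\<close>

text \<open>Isomorphisms \<open>D \<otimes>\<^sub>F K \<cong> M\<^sub>d(K)\<close> of \<open>K\<close>-algebras, where \<open>K\<close> acts on the tensor product
  through \<open>c \<mapsto> 1 \<otimes> c\<close>.\<close>

definition splitting_isomorphism ::
    "('f::field \<Rightarrow> 'd::division_ring) \<Rightarrow> ('f \<Rightarrow> 'k::field) \<Rightarrow> nat
      \<Rightarrow> (('d, 'k) tensor_word set \<Rightarrow> 'k mat) \<Rightarrow> bool" where
  "splitting_isomorphism \<iota>\<^sub>D \<iota>\<^sub>K d \<Phi> \<longleftrightarrow>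
     \<Phi> \<in> ring_iso (tensor_ring \<iota>\<^sub>D \<iota>\<^sub>K) (ring_mat TYPE('k) d ()) \<and>
     (\<forall>c. \<Phi> (pure_tensor \<iota>\<^sub>D \<iota>\<^sub>K 1 c) = c \<cdot>\<^sub>m 1\<^sub>m d)"

definition splitting_field ::
    "('f::field \<Rightarrow> 'd::division_ring) \<Rightarrow> ('f \<Rightarrow> 'k::field) \<Rightarrow> nat \<Rightarrow> bool" where
  "splitting_field \<iota>\<^sub>D \<iota>\<^sub>K d \<longleftrightarrow> field_hom \<iota>\<^sub>K \<and> (\<exists>\<Phi>. splitting_isomorphism \<iota>\<^sub>D \<iota>\<^sub>K d \<Phi>)"

definition splitting_representation ::
    "('f::field \<Rightarrow> 'd::division_ring) \<Rightarrow> ('f \<Rightarrow> 'k::field) \<Rightarrow> nat \<Rightarrow> ('d \<Rightarrow> 'k mat) \<Rightarrow> bool" where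
  "splitting_representation \<iota>\<^sub>D \<iota>\<^sub>K d \<phi> \<longleftrightarrow>
     (\<exists>\<Phi>. splitting_isomorphism \<iota>\<^sub>D \<iota>\<^sub>K d \<Phi> \<and> (\<forall>x. \<phi> x = \<Phi> (pure_tensor \<iota>\<^sub>D \<iota>\<^sub>K x 1)))"

section \<open>Monomial matrices\<close>

definition GL :: "'k::field itself \<Rightarrow> nat \<Rightarrow> 'k mat monoid" where
  "GL TYPE('k) d = units_of (ring_mat TYPE('k) d ())"

definition monomial_mat :: "nat \<Rightarrow> 'k::zero mat \<Rightarrow> bool" where
  "monomial_mat d A \<longleftrightarrow> A \<in> carrier_mat d d \<and>
     (\<forall>i<d. \<exists>!j. j < d \<and> A $$ (i, j) \<noteq> 0) \<and> (\<forall>j<d. \<exists>!i. i < d \<and> A $$ (i, j) \<noteq> 0)"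

definition monomial_group :: "'k::field itself \<Rightarrow> nat \<Rightarrow> 'k mat monoid" where
  "monomial_group TYPE('k) d =
     (GL TYPE('k) d)\<lparr>carrier := {A \<in> carrier (GL TYPE('k) d). monomial_mat d A}\<rparr>"

definition torus :: "'k::field itself \<Rightarrow> nat \<Rightarrow> 'k mat set" where
  "torus TYPE('k) d = {A \<in> carrier (GL TYPE('k) d). diagonal_mat A}"

text \<open>Indices run over \<open>{..<d}\<close>. A monomial matrix sends the line of the \<open>j\<close>-th standard basis
  vector to that of the \<open>\<sigma> j\<close>-th, so \<open>\<sigma> j\<close> is the row of the nonzero entry of column \<open>j\<close>; with this
  choice \<open>\<sigma>\<close> depends homomorphically on the matrix.\<close>

definition monomial_perm :: "nat \<Rightarrow> 'k::zero mat \<Rightarrow> nat \<Rightarrow> nat" where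
  "monomial_perm d A = (\<lambda>j. if j < d then THE i. i < d \<and> A $$ (i, j) \<noteq> 0 else j)"

text \<open>All members of a coset of the diagonal group have the same permutation, so the image is a
  singleton.\<close>

definition coset_perm :: "nat \<Rightarrow> 'k::zero mat set \<Rightarrow> nat \<Rightarrow> nat" where
  "coset_perm d X = the_elem (monomial_perm d ` X)"

definition features_cycle :: "nat \<Rightarrow> nat \<Rightarrow> (nat \<Rightarrow> nat) \<Rightarrow> bool" where
  "features_cycle d k \<sigma> \<longleftrightarrow>
     (\<exists>cs p. cycle cs \<and> length cs = k \<and> set cs \<subseteq> {..<d} \<and>
        cycle_decomp ({..<d} - set cs) p \<and> \<sigma> = cycle_of_list cs \<circ> p)"

end

theory Submission
  imports Defs "HOL-Library.Function_Algebras"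
begin

text \<open>
  Let \<open>W = gzg\<inverse>\<close> be monomial with permutation \<open>\<sigma>\<close> having a \<open>k\<close>-cycle, \<open>d/2 < k < d\<close>, let \<open>m\<close> be the
  degree of \<open>z\<close> over \<open>F\<close>, and let \<open>\<psi>\<close> be the splitting representation conjugated by \<open>g\<close>. Suppose
  such a \<open>z\<close> exists.

  \<^item> \<open>D\<close> is a free right module over the field \<open>F(z)\<close>, of rank \<open>d\<^sup>2/m\<close>
    (lemma \<open>free_over_adjoin\<close>). As \<open>\<psi> D\<close> spans \<open>M\<^sub>d(K)\<close> over \<open>K\<close>, the matrices \<open>\<psi>(y) W\<^sup>j\<close>, with
    \<open>y\<close> in an \<open>F(z)\<close>-basis of \<open>D\<close>, span \<open>M\<^sub>d(K)\<close>.

  \<^item> Consequently \<open>W\<^sup>c\<close> has few eigenvectors: if \<open>U\<close> is a \<open>d \<times> r\<close> matrix of rank \<open>r\<close> with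
    \<open>W\<^sup>c U = b U\<close>, then \<open>M \<mapsto> M U\<close> maps \<open>M\<^sub>d(K)\<close> onto the space of \<open>d \<times> r\<close> matrices, and the image
    is already spanned by the \<open>\<psi>(y) W\<^sup>j U\<close> with \<open>j < c\<close>. Hence \<open>r d \<le> c d\<^sup>2/m\<close>
    (lemma \<open>eigenvectors_le\<close>).

  \<^item> The \<open>k\<close>-cycle provides \<open>k\<close> eigenvectors of \<open>W\<^sup>k\<close> with one eigenvalue \<open>a\<close>, so \<open>m \<le> d < 2k\<close>. On
    its coordinate subspace \<open>W\<close> acts as the companion matrix of \<open>x\<^sup>k - a\<close> (up to rescaling basis
    vectors), so \<open>x\<^sup>k - a\<close> divides the minimal polynomial \<open>f\<close> of \<open>z\<close> over \<open>K\<close>. The cofactor has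
    degree \<open>m - k < k\<close>, therefore its coefficients occur among those of \<open>f\<close>, and the factorisation
    is defined over \<open>F\<close>. Minimality of \<open>f\<close> forces \<open>z\<^sup>k = a \<in> F\<close> and \<open>k \<le> m\<close>
    (lemma \<open>power_scalar\<close>).

  \<^item> Since \<open>k < d\<close>, there is another cycle, of length \<open>c \<le> d - k < k\<close>; let \<open>b\<close> be the product of the
    nonzero entries of \<open>W\<close> on it. From \<open>W\<^sup>k = a\<close> one gets \<open>c dvd k\<close> and \<open>b\<^bsup>k/c\<^esup> = a\<close>, so \<open>x\<^sup>c - b\<close> divides
    \<open>x\<^sup>k - a\<close>. Both cycles therefore contribute \<open>c\<close> eigenvectors of \<open>W\<^sup>c\<close> with eigenvalue \<open>b\<close>, and
    \<open>2 c d \<le> c d\<^sup>2/m\<close> gives \<open>2k \<le> 2m \<le> d\<close>, a contradiction (lemma \<open>no_second_cycle\<close>).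
\<close>

section \<open>Division algebras as modules over the subfield generated by an element\<close>

text \<open>
  A positive dimension encodes finiteness, because the library gives infinite-dimensional spaces the
  dimension \<open>0\<close>.
\<close>

locale finite_dim_division_algebra =
  fixes \<iota> :: "'f::field \<Rightarrow> 'd::division_ring"
  assumes hom: "Ring_Hom.ring_hom \<iota>"
    and central: "\<iota> a * x = x * \<iota> a"
    and dim_pos: "0 < vector_space.dim (\<lambda>a x. \<iota> a * x) UNIV"
begin

sublocale Ring_Hom.ring_hom \<iota>
  by (rule hom)

sublocale vector_space "\<lambda>a x. \<iota> a * x"
  by unfold_locales (simp_all add: algebra_simps hom_add hom_mult)

sublocale finite_dimensional_vector_space "\<lambda>a x. \<iota> a * x"
  "SOME B. finite B \<and> independent B \<and> span B = UNIV"
proof -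
  obtain B where B: "independent B" "UNIV \<subseteq> span B" "card B = dim UNIV"
    by (rule basis_exists)
  have "finite B"
    using B(3) dim_pos card_gt_0_iff by metis
  with B have "\<exists>B. finite B \<and> independent B \<and> span B = UNIV"
    by blast
  from someI_ex[OF this]
  show "finite_dimensional_vector_space (\<lambda>a x. \<iota> a * x)
      (SOME B. finite B \<and> independent B \<and> span B = UNIV)"
    by unfold_locales auto
qed

lemma linear_mult_left: "Vector_Spaces.linear (\<lambda>a x. \<iota> a * x) (\<lambda>a x. \<iota> a * x) (\<lambda>u. y * u)"
proof unfold_locales
  fix a and u v :: 'd
  show "y * (u + v) = y * u + y * v"
    by (rule distrib_left)
  show "y * (\<iota> a * u) = \<iota> a * (y * u)"
    by (metis central mult.assoc)
qed

lemma dim_mult_left: "y \<noteq> 0 \<Longrightarrow> dim ((\<lambda>u. y * u) ` S) = dim S"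
proof -
  assume "y \<noteq> 0"
  interpret finite_dimensional_vector_space_pair_1 "\<lambda>a x. \<iota> a * x"
    "SOME B. finite B \<and> independent B \<and> span B = UNIV" "\<lambda>a x. \<iota> a * x" ..
  show ?thesis
    by (rule dim_image_eq[OF linear_mult_left]) (simp add: \<open>y \<noteq> 0\<close> inj_on_def)
qed

text \<open>
  The field \<open>F(z)\<close>: the powers of \<open>z\<close> span it because \<open>z\<close> is algebraic over \<open>F\<close>.
\<close>

definition adjoin :: "'d \<Rightarrow> 'd set" where
  "adjoin z = span (range (\<lambda>j. z ^ j))"

lemma subspace_adjoin: "subspace (adjoin z)"
  by (simp add: adjoin_def)

lemma power_in_adjoin: "z ^ j \<in> adjoin z"
  by (simp add: adjoin_def span_base)

lemma span_mult_closed: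
  assumes S: "subspace S" and gens: "\<And>g h. g \<in> G \<Longrightarrow> h \<in> H \<Longrightarrow> g * h \<in> S"
    and "x \<in> span G" and "y \<in> span H"
  shows "x * y \<in> S"
proof -
  have right: "g * y \<in> S" if "g \<in> G" for g
    using \<open>y \<in> span H\<close>
  proof (induction rule: span_induct_alt)
    case base
    show ?case using S by (simp add: subspace_0)
  next
    case (step c h y)
    have "g * (\<iota> c * h + y) = \<iota> c * (g * h) + g * y"
      by (metis central distrib_left mult.assoc)
    then show ?case
      using S step gens[OF that] by (simp add: subspace_add subspace_scale)
  qed
  show ?thesis
    using \<open>x \<in> span G\<close>
  proof (induction rule: span_induct_alt)
    case base
    show ?case using S by (simp add: subspace_0)
  next
    case (step c g x)
    then show ?case
      using S right by (simp add: distrib_right mult.assoc subspace_add subspace_scale)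
  qed
qed

lemma adjoin_mult: "u \<in> adjoin z \<Longrightarrow> v \<in> adjoin z \<Longrightarrow> u * v \<in> adjoin z"
  unfolding adjoin_def[of z]
  by (rule span_mult_closed[of _ "range (\<lambda>j. z ^ j)" "range (\<lambda>j. z ^ j)"])
     (auto simp: power_add[symmetric] intro: span_base)

text \<open>
  Left multiplication by \<open>u\<close> is injective on the finite-dimensional space \<open>F[z]\<close>, hence onto, hence
  hits \<open>1\<close>.
\<close>

lemma adjoin_inverse:
  assumes "u \<in> adjoin z" "u \<noteq> 0"
  obtains v where "v \<in> adjoin z" "u * v = 1"
proof -
  have "(\<lambda>v. u * v) ` adjoin z = adjoin z"
  proof (rule subspace_dim_equal)
    interpret l: Vector_Spaces.linear "\<lambda>a x. \<iota> a * x" "\<lambda>a x. \<iota> a * x" "\<lambda>v. u * v"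
      by (rule linear_mult_left)
    show "subspace ((\<lambda>v. u * v) ` adjoin z)"
      by (rule l.subspace_image[OF subspace_adjoin])
    show "dim (adjoin z) \<le> dim ((\<lambda>v. u * v) ` adjoin z)"
      using assms(2) by (simp add: dim_mult_left)
  qed (use assms adjoin_mult subspace_adjoin in auto)
  then have "1 \<in> (\<lambda>v. u * v) ` adjoin z"
    using power_in_adjoin[of z 0] by simp
  with that show ?thesis by auto
qed

text \<open>
  The right \<open>F(z)\<close>-submodule of \<open>D\<close> generated by \<open>Y\<close>.
\<close>

definition orbit_span :: "'d \<Rightarrow> 'd set \<Rightarrow> 'd set" where
  "orbit_span z Y = span {y * z ^ j | y j. y \<in> Y}"

lemma orbit_span_mult: "x \<in> orbit_span z Y \<Longrightarrow> u \<in> adjoin z \<Longrightarrow> x * u \<in> orbit_span z Y"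
  unfolding orbit_span_def[of z Y] adjoin_def
  by (rule span_mult_closed[of _ "{y * z ^ j | y j. y \<in> Y}" "range (\<lambda>j. z ^ j)"])
     (auto simp: power_add[symmetric] mult.assoc intro!: span_base, blast)

lemma orbit_span_insert:
  "orbit_span z (insert y Y) = {a + b | a b. a \<in> (\<lambda>u. y * u) ` adjoin z \<and> b \<in> orbit_span z Y}"
proof -
  interpret l: Vector_Spaces.linear "\<lambda>a x. \<iota> a * x" "\<lambda>a x. \<iota> a * x" "\<lambda>v. y * v"
    by (rule linear_mult_left)
  have "{x * z ^ j | x j. x \<in> insert y Y} =
      (\<lambda>u. y * u) ` range (\<lambda>j. z ^ j) \<union> {x * z ^ j | x j. x \<in> Y}"
    by auto
  then show ?thesis
    unfolding orbit_span_def adjoin_def by (simp only: span_Un l.span_image)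
qed

text \<open>
  The submodules \<open>y F(z)\<close> and \<open>orbit_span z Y\<close> meet only in \<open>0\<close>: from \<open>y u\<close> in the latter with
  \<open>u \<noteq> 0\<close> one recovers \<open>y\<close> by multiplying with \<open>u\<inverse> \<in> F(z)\<close>. So the new generator adds a full copy
  of \<open>F(z)\<close>.
\<close>

lemma dim_orbit_span_insert:
  assumes "y \<notin> orbit_span z Y"
  shows "dim (orbit_span z (insert y Y)) = dim (orbit_span z Y) + dim (adjoin z)"
proof -
  let ?E = "(\<lambda>u. y * u) ` adjoin z"
  have sub: "subspace (orbit_span z Y)"
    by (simp add: orbit_span_def)
  then have "y \<noteq> 0"
    using assms subspace_0 by blast
  interpret l: Vector_Spaces.linear "\<lambda>a x. \<iota> a * x" "\<lambda>a x. \<iota> a * x" "\<lambda>v. y * v"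
    by (rule linear_mult_left)
  have "?E \<inter> orbit_span z Y \<subseteq> {0}"
  proof
    fix s assume s: "s \<in> ?E \<inter> orbit_span z Y"
    then obtain u where u: "u \<in> adjoin z" "s = y * u" by auto
    show "s \<in> {0}"
    proof (rule ccontr)
      assume "s \<notin> {0}"
      with u have "u \<noteq> 0" by auto
      then obtain v where "v \<in> adjoin z" "u * v = 1"
        using adjoin_inverse u by blast
      then have "y \<in> orbit_span z Y"
        using orbit_span_mult[of s z Y v] s u by (simp add: mult.assoc)
      with assms show False ..
    qed
  qed
  then have "dim (?E \<inter> orbit_span z Y) = 0"
    by simp
  with dim_sums_Int[of ?E "orbit_span z Y"] l.subspace_image[OF subspace_adjoin] sub
  show ?thesis
    unfolding orbit_span_insert by (simp add: dim_mult_left \<open>y \<noteq> 0\<close>)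
qed

lemma dim_adjoin_pos: "0 < dim (adjoin z)"
proof -
  have "1 \<in> adjoin z"
    using power_in_adjoin[of z 0] by simp
  then have "\<not> adjoin z \<subseteq> {0}" by auto
  then show ?thesis
    using dim_eq_0 by blast
qed

text \<open>
  Adjoining generators outside of the current submodule must stop, and each one adds \<open>[F(z) : F]\<close> to
  the dimension. This is the freeness of \<open>D\<close> over \<open>F(z)\<close>, as a count of dimensions.
\<close>

lemma free_over_adjoin:
  obtains Y where "finite Y" "card Y * dim (adjoin z) = dim UNIV" "orbit_span z Y = UNIV"
proof -
  define P where "P n \<longleftrightarrow>
    (\<exists>Y. finite Y \<and> card Y = n \<and> dim (orbit_span z Y) = n * dim (adjoin z))" for n
  have P0: "P 0"
    unfolding P_def by (rule exI[of _ "{}"]) (simp add: orbit_span_def)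
  have bound: "n \<le> dimension" if n: "P n" for n
  proof -
    obtain Y where "dim (orbit_span z Y) = n * dim (adjoin z)"
      using n unfolding P_def by blast
    with dim_subset_UNIV[of "orbit_span z Y"] have "n * dim (adjoin z) \<le> dimension"
      by simp
    moreover have "n \<le> n * dim (adjoin z)"
      using dim_adjoin_pos[of z] by simp
    ultimately show ?thesis by linarith
  qed
  \<comment> \<open>Generating sets that are free over \<open>F(z)\<close> are bounded in size; take a largest one.\<close>
  define n where "n = Greatest P"
  have n: "P n"
    unfolding n_def using P0 bound by (rule GreatestI_nat)
  have max: "n' \<le> n" if "P n'" for n'
    unfolding n_def using that bound by (rule Greatest_le_nat)
  obtain Y where Y: "finite Y" "card Y = n" "dim (orbit_span z Y) = n * dim (adjoin z)"
    using n unfolding P_def by blast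
  have full: "orbit_span z Y = UNIV"
  proof (rule ccontr)
    assume "orbit_span z Y \<noteq> UNIV"
    then obtain y where y: "y \<notin> orbit_span z Y" by blast
    have "y * z ^ 0 \<in> orbit_span z Y" if "y \<in> Y"
      unfolding orbit_span_def using that by (intro span_base) blast
    with y have "y \<notin> Y" by auto
    with Y have "P (Suc n)"
      unfolding P_def by (intro exI[of _ "insert y Y"]) (simp add: dim_orbit_span_insert[OF y])
    from max[OF this] show False by simp
  qed
  show ?thesis
    by (rule that[OF Y(1) _ full]) (use Y full in simp)
qed

text \<open>
  The minimal polynomial of \<open>z\<close> over \<open>F\<close>, in terms of its coefficients: a monic relation whose degree
  is \<open>[F(z) : F]\<close>, and no relation of smaller degree.
\<close>

lemma minimal_relation:
  obtains f where "z ^ dim (adjoin z) = (\<Sum>j<dim (adjoin z). \<iota> (f j) * z ^ j)"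
    and "\<And>c j. (\<Sum>j<dim (adjoin z). \<iota> (c j) * z ^ j) = 0 \<Longrightarrow> j < dim (adjoin z) \<Longrightarrow> c j = 0"
proof -
  define P where "P m = (\<lambda>j. z ^ j) ` {..<m}" for m :: nat
  have P_Suc: "P (Suc m) = insert (z ^ m) (P m)" for m
    by (simp add: P_def lessThan_Suc)
  have indep: "independent (P m) \<and> card (P m) = m" if "\<forall>i<m. z ^ i \<notin> span (P i)" for m
    using that
  proof (induction m)
    case 0
    show ?case by (simp add: P_def independent_empty)
  next
    case (Suc m)
    then have "z ^ m \<notin> P m"
      using span_base by blast
    with Suc show ?case
      by (simp add: P_Suc independent_insertI) (simp add: P_def)
  qed
  have "\<exists>m. z ^ m \<in> span (P m)"
  proof (rule ccontr)
    assume "\<nexists>m. z ^ m \<in> span (P m)"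
    then have "card (P (Suc dimension)) = Suc dimension" "independent (P (Suc dimension))"
      using indep by blast+
    with independent_bound_general[of "P (Suc dimension)"] dim_subset_UNIV[of "P (Suc dimension)"]
    show False
      by linarith
  qed
  \<comment> \<open>The first power depending on the earlier ones; the powers before it form a basis of \<open>F[z]\<close>.\<close>
  define m where "m = (LEAST m. z ^ m \<in> span (P m))"
  have m: "z ^ m \<in> span (P m)"
    unfolding m_def by (rule LeastI_ex) fact
  have ind: "independent (P m)" "card (P m) = m"
    using indep[of m] not_less_Least unfolding m_def by blast+
  have step: "x * z \<in> span (P m)" if "x \<in> span (P m)" for x
  proof (rule span_mult_closed[of _ "P m" "{z}"])
    fix g h assume "g \<in> P m" "h \<in> {z}"
    then obtain j where j: "j < m" "g * h = z ^ Suc j"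
      by (auto simp: P_def power_commutes)
    show "g * h \<in> span (P m)"
    proof (cases "Suc j = m")
      case True
      with m j show ?thesis by metis
    next
      case False
      with j have "z ^ Suc j \<in> P m" unfolding P_def by (intro imageI) simp
      with j show ?thesis by (simp only: span_base)
    qed
  qed (auto simp: that span_base)
  have pow: "z ^ j \<in> span (P m)" for j
  proof (induction j)
    case 0
    show ?case
    proof (cases "m = 0")
      case True
      with m show ?thesis by simp
    next
      case False
      then have "z ^ 0 \<in> P m" unfolding P_def by blast
      then show ?thesis by (rule span_base)
    qed
  next
    case (Suc j)
    from step[OF this] show ?case by (simp add: power_commutes)
  qed
  have "adjoin z = span (P m)"
    unfolding adjoin_def
  proof (rule antisym)
    show "span (range (\<lambda>j. z ^ j)) \<subseteq> span (P m)"
      using pow by (intro span_minimal) auto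
    show "span (P m) \<subseteq> span (range (\<lambda>j. z ^ j))"
      by (rule span_mono) (auto simp: P_def)
  qed
  then have dim: "dim (adjoin z) = m"
    using ind by (simp add: dim_eq_card_independent)
  have inj: "inj_on (\<lambda>j. z ^ j) {..<m}"
    by (rule eq_card_imp_inj_on) (use ind in \<open>simp_all add: P_def\<close>)
  have sum_P: "(\<Sum>v\<in>P m. h v) = (\<Sum>j<m. h (z ^ j))" for h :: "'d \<Rightarrow> 'd"
    by (simp add: P_def sum.reindex[OF inj])
  obtain r where "z ^ m = (\<Sum>v\<in>P m. \<iota> (r v) * v)"
    using m span_finite[of "P m"] by (auto simp: P_def)
  then have r: "z ^ m = (\<Sum>j<m. \<iota> (r (z ^ j)) * z ^ j)"
    by (simp add: sum_P)
  have c: "c j = 0" if "(\<Sum>j<m. \<iota> (c j) * z ^ j) = 0" "j < m" for c j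
  proof -
    define c' where "c' v = c (the_inv_into {..<m} (\<lambda>j. z ^ j) v)" for v
    have c': "c' (z ^ j) = c j" if "j < m" for j
      using the_inv_into_f_f[OF inj] that by (simp add: c'_def)
    have "(\<Sum>v\<in>P m. \<iota> (c' v) * v) = 0"
      using that(1) c' by (simp add: sum_P)
    then have "c' (z ^ j) = 0"
      using ind(1) that(2) unfolding independent_explicit by (auto simp: P_def)
    with c' that(2) show ?thesis by simp
  qed
  show ?thesis
    by (rule that[of "\<lambda>j. r (z ^ j)"]) (use r c dim in auto)
qed

end

section \<open>Counting eigenvectors in a spanning representation\<close>

abbreviation fun_scale :: "'k::field \<Rightarrow> ('a \<Rightarrow> 'k) \<Rightarrow> 'a \<Rightarrow> 'k" where
  "fun_scale a f \<equiv> \<lambda>s. a * f s"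

interpretation fun_space: vector_space fun_scale
  by unfold_locales (auto simp: algebra_simps fun_eq_iff)

definition unit_fun :: "'a \<Rightarrow> 'a \<Rightarrow> 'k::field" where
  "unit_fun a = (\<lambda>s. if s = a then 1 else 0)"

lemma inj_unit_fun: "inj unit_fun"
  by (auto simp: inj_def unit_fun_def fun_eq_iff split: if_splits)

lemma sum_fun_apply: "(\<Sum>v\<in>V. f v) s = (\<Sum>v\<in>V. f v s)"
  by (induction V rule: infinite_finite_induct) auto

text \<open>
  For finite \<open>A\<close> the functions supported on \<open>A\<close> form a space of dimension \<open>card A\<close>. Linear
  independence in spaces of functions replaces that in spaces of matrices, whose carrier is not a
  whole type.
\<close>

lemma card_le_if_span_unit_funs:
  fixes G :: "('a \<Rightarrow> 'k::field) set"
  assumes "finite A" "finite G" and span: "\<And>a. a \<in> A \<Longrightarrow> unit_fun a \<in> fun_space.span G"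
  shows "card A \<le> card G"
proof -
  let ?U = "unit_fun ` A :: ('a \<Rightarrow> 'k) set"
  have "r v = 0" if sum0: "(\<Sum>v\<in>?U. fun_scale (r v) v) = 0" and "v \<in> ?U" for r v
  proof -
    obtain a where a: "a \<in> A" "v = unit_fun a"
      using \<open>v \<in> ?U\<close> by blast
    have "0 = (\<Sum>v\<in>?U. fun_scale (r v) v) a"
      by (simp add: sum0)
    also have "\<dots> = (\<Sum>x\<in>A. r (unit_fun x) * unit_fun x a)"
      unfolding sum_fun_apply using inj_on_subset[OF inj_unit_fun subset_UNIV]
      by (subst sum.reindex) auto
    also have "\<dots> = (\<Sum>x\<in>A. if x = a then r (unit_fun a) else 0)"
      by (rule sum.cong) (auto simp: unit_fun_def)
    also have "\<dots> = r v"
      using a \<open>finite A\<close> by simp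
    finally show ?thesis by simp
  qed
  then have "fun_space.independent ?U"
    using \<open>finite A\<close> by (subst fun_space.dependent_finite) auto
  moreover have "?U \<subseteq> fun_space.span G"
    using span by blast
  ultimately have "card ?U \<le> card G"
    using fun_space.independent_span_bound[OF \<open>finite G\<close>] by blast
  then show ?thesis
    using card_image[OF inj_on_subset[OF inj_unit_fun subset_UNIV]] by metis
qed

text \<open>
  The features of a splitting representation that the argument rests on: an algebra homomorphism
  \<open>D \<rightarrow> M\<^sub>d(K)\<close> whose image spans \<open>M\<^sub>d(K)\<close> over \<open>K\<close>. Linear combinations are written entrywise because
  matrices of all sizes share one type, on which addition has no neutral element.
\<close>

locale spanning_representation = finite_dim_division_algebra \<iota>\<^sub>D + K: field_hom \<iota>\<^sub>K
  for \<iota>\<^sub>D :: "'f::field \<Rightarrow> 'd::division_ring" and \<iota>\<^sub>K :: "'f \<Rightarrow> 'k::field" +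
  fixes d :: nat and \<psi> :: "'d \<Rightarrow> 'k mat"
  assumes degree: "dim UNIV = d\<^sup>2"
    and carrier: "\<psi> x \<in> carrier_mat d d"
    and rep_add: "\<psi> (x + y) = \<psi> x + \<psi> y"
    and rep_mult: "\<psi> (x * y) = \<psi> x * \<psi> y"
    and rep_scalar: "\<psi> (\<iota>\<^sub>D t) = \<iota>\<^sub>K t \<cdot>\<^sub>m 1\<^sub>m d"
    and spanning: "E \<in> carrier_mat d d \<Longrightarrow>
      \<exists>S c. finite S \<and> (\<forall>p<d. \<forall>q<d. E $$ (p, q) = (\<Sum>x\<in>S. c x * \<psi> x $$ (p, q)))"
begin

text \<open>
  The action of \<open>D\<close> on column vectors. Vectors are functions, of which only the values on
  \<open>{..<d}\<close> matter.
\<close>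

definition act :: "'d \<Rightarrow> (nat \<Rightarrow> 'k) \<Rightarrow> nat \<Rightarrow> 'k" where
  "act x u q = (\<Sum>p<d. \<psi> x $$ (q, p) * u p)"

lemma act_add: "q < d \<Longrightarrow> act (x + y) u q = act x u q + act y u q"
  using carrier[of x] carrier[of y] by (simp add: act_def rep_add algebra_simps sum.distrib)

lemma act_mult: 
  assumes "q < d"
  shows "act (x * y) u q = act x (act y u) q"
proof -
  have "act (x * y) u q = (\<Sum>p<d. (\<Sum>i<d. \<psi> x $$ (q, i) * \<psi> y $$ (i, p)) * u p)"
    unfolding act_def rep_mult using carrier[of x] carrier[of y] assms
    by (intro sum.cong refl) (simp add: scalar_prod_def lessThan_atLeast0)
  also have "\<dots> = (\<Sum>i<d. \<Sum>p<d. \<psi> x $$ (q, i) * \<psi> y $$ (i, p) * u p)"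
    by (simp add: sum_distrib_right) (rule sum.swap)
  also have "\<dots> = act x (act y u) q"
    by (simp add: act_def sum_distrib_left mult.assoc)
  finally show ?thesis .
qed

lemma act_scalar:
  assumes "q < d"
  shows "act (\<iota>\<^sub>D t) u q = \<iota>\<^sub>K t * u q"
proof -
  have "act (\<iota>\<^sub>D t) u q = (\<Sum>p<d. if p = q then \<iota>\<^sub>K t * u q else 0)"
    unfolding act_def rep_scalar using assms by (intro sum.cong) auto
  also have "\<dots> = \<iota>\<^sub>K t * u q"
    using assms by simp
  finally show ?thesis .
qed

lemma act_scale: "q < d \<Longrightarrow> act (\<iota>\<^sub>D t * x) u q = \<iota>\<^sub>K t * act x u q"
  by (simp add: act_mult act_scalar)

lemma act_zero: "q < d \<Longrightarrow> act 0 u q = 0"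
  using act_scalar[of q 0] by simp

lemma act_one: "q < d \<Longrightarrow> act 1 u q = u q"
  using act_scalar[of q 1] by simp

lemma act_sum: "q < d \<Longrightarrow> act (\<Sum>s\<in>S. f s) u q = (\<Sum>s\<in>S. act (f s) u q)"
  by (induction S rule: infinite_finite_induct) (simp_all add: act_zero act_add)

lemma act_cong: "(\<And>p. p < d \<Longrightarrow> u p = v p) \<Longrightarrow> act x u q = act x v q"
  by (simp add: act_def)

lemma act_scale_vec: "act x (\<lambda>p. b * u p) q = b * act x u q"
  by (simp add: act_def sum_distrib_left algebra_simps)

lemma act_sum_vec: "act x (\<lambda>p. \<Sum>s\<in>S. u s p) q = (\<Sum>s\<in>S. act x (u s) q)"
  unfolding act_def by (simp add: sum_distrib_left) (rule sum.swap)

text \<open>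
  Let \<open>U\<close> be the matrix with columns \<open>u i\<close>. The positions \<open>pos\<close> make a submatrix of \<open>U\<close> diagonal and
  invertible, so \<open>M \<mapsto> M U\<close> is onto the matrices with \<open>d\<close> rows and columns indexed by \<open>I\<close>. The map
  \<open>T x = \<psi>(x) U\<close> satisfies \<open>T (x z\<^sup>c) = b T x\<close>; therefore the \<open>card Y * c\<close> elements \<open>T (y z\<^sup>j)\<close> with
  \<open>j < c\<close> span the range of \<open>T\<close>, and with it all these matrices.
\<close>

lemma eigenvectors_le:
  fixes u :: "'i \<Rightarrow> nat \<Rightarrow> 'k"
  assumes Y: "finite Y" "orbit_span z Y = UNIV"
    and eigen: "\<And>i q. i \<in> I \<Longrightarrow> q < d \<Longrightarrow> act (z ^ c) (u i) q = b * u i q"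
    and "finite I" and "0 < c"
    and pos: "\<And>i. i \<in> I \<Longrightarrow> pos i < d" "\<And>i. i \<in> I \<Longrightarrow> u i (pos i) \<noteq> 0"
    and zero: "\<And>i j. i \<in> I \<Longrightarrow> j \<in> I \<Longrightarrow> i \<noteq> j \<Longrightarrow> u i (pos j) = 0"
  shows "card I * d \<le> card Y * c"
proof -
  define T where "T x = (\<lambda>(i, q). if i \<in> I \<and> q < d then act x (u i) q else 0)" for x
  have T_add: "T (x + y) = T x + T y" for x y
    by (auto simp: T_def fun_eq_iff act_add)
  have T_scale: "T (\<iota>\<^sub>D t * x) = fun_scale (\<iota>\<^sub>K t) (T x)" for t x
    by (auto simp: T_def fun_eq_iff act_scale)
  have T_zero: "T 0 = 0"
    by (auto simp: T_def fun_eq_iff act_zero)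
  have T_period: "T (x * z ^ c) = fun_scale b (T x)" for x
  proof -
    have "act (x * z ^ c) (u i) q = b * act x (u i) q" if "i \<in> I" "q < d" for i q
      using act_cong[of "act (z ^ c) (u i)" "\<lambda>p. b * u i p" x q] eigen that
      by (simp add: act_mult act_scale_vec)
    then show ?thesis
      by (auto simp: T_def fun_eq_iff)
  qed
  define G where "G = (\<lambda>(y, j). T (y * z ^ j)) ` (Y \<times> {..<c})"
  have orbit: "T (y * z ^ j) \<in> fun_space.span G" if "y \<in> Y" for y j
  proof (induction j rule: less_induct)
    case (less j)
    show ?case
    proof (cases "j < c")
      case True
      with that show ?thesis
        by (intro fun_space.span_base) (auto simp: G_def)
    next
      case False
      then have "T (y * z ^ j) = fun_scale b (T (y * z ^ (j - c)))"
        using T_period[of "y * z ^ (j - c)"] by (simp add: mult.assoc flip: power_add)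
      with False \<open>0 < c\<close> less[of "j - c"] show ?thesis
        by (simp add: fun_space.span_scale)
    qed
  qed
  have T_span: "T x \<in> fun_space.span G" for x
  proof -
    have "x \<in> span {y * z ^ j | y j. y \<in> Y}"
      using Y(2) by (simp add: orbit_span_def)
    then show ?thesis
    proof (induction rule: span_induct_alt)
      case base
      show ?case by (simp only: T_zero fun_space.span_zero)
    next
      case (step t g x)
      then show ?case
        using orbit by (auto simp only: T_add T_scale intro!: fun_space.span_add fun_space.span_scale)
    qed
  qed
  have "unit_fun (i, q) \<in> fun_space.span G" if "i \<in> I" "q < d" for i q
  proof -
    \<comment> \<open>\<open>E U\<close> is the matrix unit at row \<open>q\<close> and column \<open>i\<close>.\<close>
    define E where "E = mat d d (\<lambda>(q', p). if q' = q \<and> p = pos i then 1 / u i (pos i) else 0)"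
    obtain S e where S: "finite S"
      and e: "\<And>p q. p < d \<Longrightarrow> q < d \<Longrightarrow> E $$ (p, q) = (\<Sum>x\<in>S. e x * \<psi> x $$ (p, q))"
      using spanning[of E] by (auto simp: E_def)
    have "unit_fun (i, q) = (\<Sum>x\<in>S. fun_scale (e x) (T x))"
    proof
      fix s :: "'i \<times> nat"
      obtain i' q' where s: "s = (i', q')" by fastforce
      show "unit_fun (i, q) s = (\<Sum>x\<in>S. fun_scale (e x) (T x)) s"
      proof (cases "i' \<in> I \<and> q' < d")
        case False
        with that show ?thesis
          by (auto simp: unit_fun_def s T_def sum_fun_apply)
      next
        case True
        have "(\<Sum>x\<in>S. fun_scale (e x) (T x)) s = (\<Sum>x\<in>S. \<Sum>p<d. e x * \<psi> x $$ (q', p) * u i' p)"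
          using True by (simp add: sum_fun_apply s T_def act_def sum_distrib_left mult.assoc)
        also have "\<dots> = (\<Sum>p<d. E $$ (q', p) * u i' p)"
          by (subst sum.swap) (use True e in \<open>simp add: sum_distrib_right\<close>)
        also have "\<dots> = (\<Sum>p<d. if p = pos i then (if q' = q then u i' p / u i p else 0) else 0)"
          using True by (intro sum.cong) (auto simp: E_def)
        also have "\<dots> = (if q' = q then u i' (pos i) / u i (pos i) else 0)"
          using pos(1)[OF \<open>i \<in> I\<close>] by simp
        also have "\<dots> = unit_fun (i, q) s"
          using pos(2)[of i] zero[of i' i] True that by (auto simp: unit_fun_def s)
        finally show ?thesis by simp
      qed
    qed
    then show ?thesis
      by (simp only: fun_space.span_sum fun_space.span_scale T_span)
  qed
  then have "card (I \<times> {..<d}) \<le> card G"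
    using \<open>finite I\<close> Y(1) by (intro card_le_if_span_unit_funs) (auto simp: G_def)
  also have "\<dots> \<le> card (Y \<times> {..<c})"
    unfolding G_def using Y(1) by (intro card_image_le) simp
  finally show ?thesis
    by (simp add: card_cartesian_product)
qed

end

section \<open>Elements represented by a monomial matrix\<close>

lemma sum_lessThan_add:
  fixes f :: "nat \<Rightarrow> 'a::comm_monoid_add"
  shows "(\<Sum>j<m + n. f j) = (\<Sum>j<m. f j) + (\<Sum>j<n. f (m + j))"
  by (induction n) (simp_all add: add.assoc)

text \<open>
  \<open>k\<close> is the least period of \<open>i\<close> under \<open>\<sigma>\<close>.
\<close>

definition on_cycle :: "('a \<Rightarrow> 'a) \<Rightarrow> nat \<Rightarrow> 'a \<Rightarrow> bool" where
  "on_cycle \<sigma> k i \<longleftrightarrow> 0 < k \<and> (\<sigma> ^^ k) i = i \<and> inj_on (\<lambda>t. (\<sigma> ^^ t) i) {..<k}"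

text \<open>
  In this context \<open>W = \<psi> z\<close> denotes the monomial matrix, \<open>\<sigma>\<close> its permutation, and \<open>w j\<close> the nonzero
  entry of column \<open>j\<close>; \<open>e\<^sub>j\<close> is the \<open>j\<close>-th standard basis vector.
\<close>

locale monomial_element = spanning_representation +
  fixes z :: 'b and \<sigma> :: "nat \<Rightarrow> nat" and w :: "nat \<Rightarrow> 'c"
  assumes entries: "\<And>i j. i < d \<Longrightarrow> j < d \<Longrightarrow> \<psi> z $$ (i, j) = (if i = \<sigma> j then w j else 0)"
    and weight_nonzero: "\<And>j. j < d \<Longrightarrow> w j \<noteq> 0"
    and perm_less: "\<And>j. j < d \<Longrightarrow> \<sigma> j < d"
    and nonzero: "z \<noteq> 0"
begin

definition basis_vec :: "nat \<Rightarrow> nat \<Rightarrow> 'c" where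
  "basis_vec j = (\<lambda>p. if p = j then 1 else 0)"

text \<open>
  \<open>W\<^sup>t e\<^sub>j = weight t j \<cdot> e'\<close> where \<open>e'\<close> is the basis vector at \<open>\<sigma>\<^sup>t j\<close>. If \<open>j\<close> lies on a
  cycle of length \<open>t\<close>, then \<open>weight t j\<close> is the product of the nonzero entries of \<open>W\<close> on it.
\<close>

definition weight :: "nat \<Rightarrow> nat \<Rightarrow> 'c" where
  "weight t j = (\<Prod>s<t. w ((\<sigma> ^^ s) j))"

lemma funpow_less: "j < d \<Longrightarrow> (\<sigma> ^^ t) j < d"
  by (induction t) (simp_all add: perm_less)

lemma weight_neq_zero: "j < d \<Longrightarrow> weight t j \<noteq> 0"
  by (simp add: weight_def weight_nonzero funpow_less)

lemma act_power_basis_vec: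
  assumes "j < d" "q < d"
  shows "act (z ^ t) (basis_vec j) q = (if q = (\<sigma> ^^ t) j then weight t j else 0)"
  using assms(2)
proof (induction t arbitrary: q)
  case 0
  then show ?case by (simp add: act_one basis_vec_def weight_def)
next
  case (Suc t)
  have "act (z ^ Suc t) (basis_vec j) q = act z (act (z ^ t) (basis_vec j)) q"
    using Suc by (simp add: act_mult)
  also have "\<dots> = (\<Sum>p<d. if p = (\<sigma> ^^ t) j then \<psi> z $$ (q, p) * weight t j else 0)"
    unfolding act_def[of z] by (rule sum.cong) (simp_all add: Suc)
  also have "\<dots> = \<psi> z $$ (q, (\<sigma> ^^ t) j) * weight t j"
    using funpow_less[OF assms(1)] by simp
  finally show ?case
    using Suc.prems funpow_less[OF assms(1)] by (simp add: entries weight_def mult.commute)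
qed

lemma act_power_power:
  "q < d \<Longrightarrow> act (z ^ s) (act (z ^ t) u) q = act (z ^ (s + t)) u q"
  by (simp add: power_add act_mult)

lemma act_cycle:
  assumes "j < d" "(\<sigma> ^^ k) j = j" "q < d"
  shows "act (z ^ (k + t)) (basis_vec j) q = weight k j * act (z ^ t) (basis_vec j) q"
proof -
  have "act (z ^ (k + t)) (basis_vec j) q = act (z ^ t) (act (z ^ k) (basis_vec j)) q"
    using assms(3) by (simp add: act_power_power add.commute)
  also have "\<dots> = act (z ^ t) (\<lambda>p. weight k j * basis_vec j p) q"
    using assms by (intro act_cong) (simp add: act_power_basis_vec, simp add: basis_vec_def)
  finally show ?thesis
    by (simp add: act_scale_vec)
qed

text \<open>
  The vectors \<open>W\<^sup>t e\<^sub>i\<close>, \<open>t < k\<close>, are eigenvectors of \<open>W\<^sup>k\<close> and are multiples of distinct basis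
  vectors, so \<open>k d \<le> k card Y\<close>.
\<close>

lemma degree_le_card_generators:
  assumes Y: "finite Y" "orbit_span z Y = UNIV"
    and i: "i < d" "on_cycle \<sigma> k i"
  shows "d \<le> card Y"
proof -
  have "card {..<k} * d \<le> card Y * k"
  proof (rule eigenvectors_le[OF Y, where u = "\<lambda>t. act (z ^ t) (basis_vec i)"
        and b = "weight k i" and pos = "\<lambda>t. (\<sigma> ^^ t) i"])
    fix t q assume "q < d"
    then show "act (z ^ k) (act (z ^ t) (basis_vec i)) q =
        weight k i * act (z ^ t) (basis_vec i) q"
      using i act_cycle[of i k q t] by (simp add: act_power_power on_cycle_def)
  next
    fix s t assume "s \<in> {..<k}" "t \<in> {..<k}" "s \<noteq> t"
    then have "(\<sigma> ^^ t) i \<noteq> (\<sigma> ^^ s) i"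
      using i unfolding on_cycle_def inj_on_def by blast
    then show "act (z ^ s) (basis_vec i) ((\<sigma> ^^ t) i) = 0"
      using i by (simp add: act_power_basis_vec funpow_less)
  qed (use i in \<open>auto simp: on_cycle_def funpow_less act_power_basis_vec weight_neq_zero\<close>)
  then show ?thesis
    using i by (simp add: on_cycle_def)
qed

lemma dim_adjoin_le_degree:
  assumes "i < d" "on_cycle \<sigma> k i"
  shows "dim (adjoin z) \<le> d"
proof -
  obtain Y where Y: "finite Y" "card Y * dim (adjoin z) = dim UNIV" "orbit_span z Y = UNIV"
    by (rule free_over_adjoin)
  have "d \<le> card Y"
    using degree_le_card_generators[OF Y(1,3) assms] .
  then have "d * dim (adjoin z) \<le> d * d"
    using Y(2) degree by (metis mult_le_mono1 power2_eq_square)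
  with assms show ?thesis by simp
qed

text \<open>
  With \<open>F j\<close> the coefficients of the minimal polynomial, \<open>f(W) e\<^sub>i = 0\<close> and \<open>W\<^sup>k e\<^sub>i = a e\<^sub>i\<close> give
  \<open>F r = - a F (k + r)\<close> for \<open>r < k\<close>, as the degree is below \<open>2k\<close>. This is the factorisation
  \<open>f = (x\<^sup>k - a) h\<close>, where \<open>h\<close> has the coefficients \<open>F (k + t)\<close>. It shows \<open>a = - F 0 / F k\<close> to be in
  the base field; evaluating at \<open>z\<close> in the division ring, one of the factors vanishes, and it is not
  \<open>h(z)\<close> by minimality.
\<close>

lemma power_scalar:
  assumes i: "i < d" "on_cycle \<sigma> k i" and large: "d < 2 * k"
  obtains a where "z ^ k = \<iota>\<^sub>D a" "k \<le> dim (adjoin z)"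
proof -
  let ?m = "dim (adjoin z)"
  let ?a = "weight k i"
  have "?m \<le> d"
    using dim_adjoin_le_degree[OF i] .
  with large have m: "?m < 2 * k" by simp
  obtain f where f: "z ^ ?m = (\<Sum>j<?m. \<iota>\<^sub>D (f j) * z ^ j)"
    and indep: "\<And>c j. (\<Sum>j<?m. \<iota>\<^sub>D (c j) * z ^ j) = 0 \<Longrightarrow> j < ?m \<Longrightarrow> c j = 0"
    using minimal_relation[of z] by blast
  \<comment> \<open>The monic minimal polynomial; padding with zeros up to degree \<open>2k - 1\<close> gives both halves \<open>k\<close> terms.\<close>
  define F where "F j = (if j < ?m then - f j else if j = ?m then 1 else 0)" for j
  have F_m: "F ?m = 1" and F_0: "F j = 0" if "?m < j" for j
    using that by (simp_all add: F_def)
  have relation: "(\<Sum>j<2 * k. \<iota>\<^sub>D (F j) * z ^ j) = 0"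
  proof -
    have "(\<Sum>j<2 * k. \<iota>\<^sub>D (F j) * z ^ j) = (\<Sum>j<Suc ?m. \<iota>\<^sub>D (F j) * z ^ j)"
      by (rule sum.mono_neutral_right) (use m in \<open>auto simp: F_def\<close>)
    also have "\<dots> = (\<Sum>j<?m. - (\<iota>\<^sub>D (f j) * z ^ j)) + z ^ ?m"
      by (simp add: F_def hom_uminus)
    also have "\<dots> = 0"
      by (simp add: f sum_negf)
    finally show ?thesis .
  qed
  have coeffs: "\<iota>\<^sub>K (F r) = - ?a * \<iota>\<^sub>K (F (k + r))" if "r < k" for r
  proof -
    let ?q = "(\<sigma> ^^ r) i"
    have q: "?q < d" using i by (simp add: funpow_less)
    have val: "act (z ^ t) (basis_vec i) ?q = (if t = r then weight r i else 0)" if "t < k" for t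
      using i q that \<open>r < k\<close> by (auto simp: act_power_basis_vec on_cycle_def dest: inj_onD)
    have "0 = act (\<Sum>j<k + k. \<iota>\<^sub>D (F j) * z ^ j) (basis_vec i) ?q"
      using relation q by (simp add: act_zero mult_2)
    also have "\<dots> = (\<Sum>j<k + k. \<iota>\<^sub>K (F j) * act (z ^ j) (basis_vec i) ?q)"
      using q by (simp add: act_sum act_scale)
    also have "\<dots> = (\<Sum>t<k. \<iota>\<^sub>K (F t) * act (z ^ t) (basis_vec i) ?q) +
        (\<Sum>t<k. \<iota>\<^sub>K (F (k + t)) * (?a * act (z ^ t) (basis_vec i) ?q))"
      using i q by (simp add: sum_lessThan_add act_cycle on_cycle_def)
    also have "\<dots> = (\<Sum>t<k. if t = r then \<iota>\<^sub>K (F r) * weight r i else 0) +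
        (\<Sum>t<k. if t = r then \<iota>\<^sub>K (F (k + r)) * (?a * weight r i) else 0)"
      by (intro arg_cong2[of _ _ _ _ "(+)"] sum.cong) (auto simp: val)
    also have "\<dots> = (\<iota>\<^sub>K (F r) + ?a * \<iota>\<^sub>K (F (k + r))) * weight r i"
      using \<open>r < k\<close> by (simp add: algebra_simps)
    finally have "\<iota>\<^sub>K (F r) + ?a * \<iota>\<^sub>K (F (k + r)) = 0"
      using weight_neq_zero[of i r] i by auto
    then show ?thesis
      by (simp add: add_eq_0_iff2)
  qed
  have "k > 0"
    using i by (simp add: on_cycle_def)
  have k_le: "k \<le> ?m"
  proof (rule ccontr)
    assume "\<not> k \<le> ?m"
    with coeffs[of ?m] \<open>k > 0\<close> show False
      by (simp add: F_def)
  qed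
  \<comment> \<open>Otherwise cancelling \<open>z\<close> would give a relation of smaller degree.\<close>
  have "F 0 \<noteq> 0"
  proof
    assume "F 0 = 0"
    have "0 = (\<Sum>j<Suc ?m. \<iota>\<^sub>D (F j) * z ^ j)"
      unfolding relation[symmetric]
      by (rule sum.mono_neutral_right) (use m in \<open>auto simp: F_def\<close>)
    also have "\<dots> = (\<Sum>j<?m. \<iota>\<^sub>D (F (Suc j)) * z ^ j) * z"
      unfolding sum.lessThan_Suc_shift
      by (simp add: \<open>F 0 = 0\<close> sum_distrib_right mult.assoc power_commutes)
    finally have "(\<Sum>j<?m. \<iota>\<^sub>D (F (Suc j)) * z ^ j) = 0"
      using nonzero by simp
    from indep[OF this, of "?m - 1"] dim_adjoin_pos[of z] show False
      by (simp add: F_def)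
  qed
  define a where "a = - F 0 / F k"
  have "F k \<noteq> 0"
    using coeffs[of 0] \<open>k > 0\<close> \<open>F 0 \<noteq> 0\<close> by auto
  have "\<iota>\<^sub>K a * \<iota>\<^sub>K (F k) = ?a * \<iota>\<^sub>K (F k)"
    using coeffs[of 0] \<open>k > 0\<close> \<open>F k \<noteq> 0\<close>
    by (simp add: a_def K.hom_uminus flip: K.hom_mult)
  then have a: "\<iota>\<^sub>K a = ?a"
    using \<open>F k \<noteq> 0\<close> by simp
  have F_shift: "F r = - a * F (k + r)" if "r < k" for r
  proof -
    have "\<iota>\<^sub>K (F r) = \<iota>\<^sub>K (- a * F (k + r))"
      using coeffs[OF that] by (simp add: a K.hom_mult K.hom_uminus)
    then show ?thesis by simp
  qed
  let ?h = "\<Sum>t<k. \<iota>\<^sub>D (F (k + t)) * z ^ t"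
  have "0 = (\<Sum>t<k. \<iota>\<^sub>D (F t) * z ^ t) + (\<Sum>t<k. \<iota>\<^sub>D (F (k + t)) * z ^ (k + t))"
    using relation by (simp add: mult_2 sum_lessThan_add)
  also have "\<dots> = (\<Sum>t<k. \<iota>\<^sub>D (F (k + t)) * z ^ t * (z ^ k - \<iota>\<^sub>D a))"
  proof (subst sum.distrib[symmetric], rule sum.cong)
    fix t assume "t \<in> {..<k}"
    then have "F t = - (F (k + t) * a)"
      using F_shift[of t] by simp
    then have "\<iota>\<^sub>D (F t) * z ^ t = - (\<iota>\<^sub>D (F (k + t)) * (\<iota>\<^sub>D a * z ^ t))"
      by (simp only: hom_mult hom_uminus minus_mult_left mult.assoc)
    also have "\<iota>\<^sub>D a * z ^ t = z ^ t * \<iota>\<^sub>D a"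
      by (rule central)
    finally show "\<iota>\<^sub>D (F t) * z ^ t + \<iota>\<^sub>D (F (k + t)) * z ^ (k + t) =
        \<iota>\<^sub>D (F (k + t)) * z ^ t * (z ^ k - \<iota>\<^sub>D a)"
      by (simp add: right_diff_distrib mult.assoc add.commute[of k t] power_add)
  qed simp
  also have "\<dots> = ?h * (z ^ k - \<iota>\<^sub>D a)"
    by (simp add: sum_distrib_right)
  finally have "?h = 0 \<or> z ^ k = \<iota>\<^sub>D a"
    by simp
  moreover have "?h \<noteq> 0"
  proof
    assume "?h = 0"
    moreover have "(\<Sum>t<?m. \<iota>\<^sub>D (F (k + t)) * z ^ t) = ?h"
      by (rule sum.mono_neutral_right) (use m k_le in \<open>auto simp: F_def\<close>)
    ultimately have "F (k + (?m - k)) = 0"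
      using indep[of "\<lambda>t. F (k + t)" "?m - k"] k_le \<open>k > 0\<close> by simp
    with k_le show False by (simp add: F_def)
  qed
  ultimately show ?thesis
    using that k_le by blast
qed

text \<open>
  The second cycle supplies the eigenvectors \<open>W\<^sup>t e\<close>, \<open>t < c\<close>, of \<open>W\<^sup>c\<close>, where \<open>e\<close> is the basis
  vector at \<open>i'\<close>. On the \<open>k\<close>-cycle, \<open>W\<^sup>k = a\<close> and \<open>a = b\<^sup>n\<close> with \<open>n = k/c\<close>, and eigenvectors of \<open>W\<^sup>c\<close>
  for \<open>b\<close> are obtained by applying the quotient of \<open>x\<^sup>k - a\<close> by \<open>x\<^sup>c - b\<close> at \<open>W\<close>, normalised to
  constant term \<open>1\<close>. Together these are \<open>2c\<close> independent eigenvectors, more than \<open>eigenvectors_le\<close> permits, because \<open>k \<le> [F(z) : F]\<close> makes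
  the rank of \<open>D\<close> over \<open>F(z)\<close> smaller than \<open>2d\<close>.
\<close>

lemma no_second_cycle:
  assumes i: "i < d" "on_cycle \<sigma> k i" and large: "d < 2 * k"
    and i': "i' < d" "on_cycle \<sigma> c i'" and "c < k"
    and disj: "\<And>s t. (\<sigma> ^^ s) i \<noteq> (\<sigma> ^^ t) i'"
  shows False
proof -
  obtain a0 where a0: "z ^ k = \<iota>\<^sub>D a0" and k_le: "k \<le> dim (adjoin z)"
    using power_scalar[OF i large] .
  define a where "a = \<iota>\<^sub>K a0"
  define b where "b = weight c i'"
  have "0 < c" and cyc': "(\<sigma> ^^ c) i' = i'" and inj': "inj_on (\<lambda>t. (\<sigma> ^^ t) i') {..<c}"
    using i' by (simp_all add: on_cycle_def)
  have "0 < k" and cyc: "(\<sigma> ^^ k) i = i" and inj: "inj_on (\<lambda>t. (\<sigma> ^^ t) i) {..<k}"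
    using i by (simp_all add: on_cycle_def)
  have act_k: "act (z ^ (k + t)) u q = a * act (z ^ t) u q" if "q < d" for t u q
    using that by (simp add: power_add a0 act_scale a_def)
  have "b \<noteq> 0"
    using i' by (simp add: b_def weight_neq_zero)
  have a_eq: "a = act (z ^ k) (basis_vec i) i"
    using act_k[of i 0] i by (simp add: act_one basis_vec_def)
  then have "a \<noteq> 0"
    using i cyc by (simp add: act_power_basis_vec weight_neq_zero)
  have act_c: "act (z ^ (c * n)) (basis_vec i') q = b ^ n * basis_vec i' q" if "q < d" for n q
  proof (induction n)
    case 0
    then show ?case using that by (simp add: act_one)
  next
    case (Suc n)
    then show ?case
      using act_cycle[OF i'(1) cyc' that, of "c * n"] by (simp add: b_def)
  qed
  have fix_k: "(\<sigma> ^^ k) i' = i'"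
  proof (rule ccontr)
    assume "(\<sigma> ^^ k) i' \<noteq> i'"
    then have "act (z ^ k) (basis_vec i') i' = 0"
      using i' by (simp add: act_power_basis_vec)
    with act_k[of i' 0 "basis_vec i'"] i' \<open>a \<noteq> 0\<close> show False
      by (simp add: act_one basis_vec_def)
  qed
  have "(\<sigma> ^^ (k mod c)) i' = i'"
    using fix_k funpow_mod_eq[OF cyc', of k] by simp
  then have "k mod c = 0"
    using inj_onD[OF inj', of "k mod c" 0] \<open>0 < c\<close> by simp
  define n where "n = k div c"
  have k: "k = c * n"
    using \<open>k mod c = 0\<close> by (simp add: n_def mod_0_imp_dvd)
  have bn: "b ^ n = a"
    using act_c[of i' n] act_k[of i' 0 "basis_vec i'"] i'
    by (simp add: k act_one basis_vec_def)
  \<comment> \<open>Indexed by the cycle (\<open>True\<close> for that of \<open>i'\<close>) and by \<open>t < c\<close>.\<close>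
  define u where "u = (\<lambda>(second, t) q.
    if second then act (z ^ t) (basis_vec i') q
    else \<Sum>j<n. (1 / b) ^ j * act (z ^ (c * j + t)) (basis_vec i) q)"
  define pos where "pos = (\<lambda>(second, t). (\<sigma> ^^ t) (if second then i' else i))"
  obtain Y where Y: "finite Y" "card Y * dim (adjoin z) = dim UNIV" "orbit_span z Y = UNIV"
    by (rule free_over_adjoin)
  have u_True: "u (True, t) q = (if q = (\<sigma> ^^ t) i' then weight t i' else 0)" if "q < d" for q t
    using i' that by (simp add: u_def act_power_basis_vec)
  \<comment> \<open>The \<open>n\<close> summands have disjoint supports, and only the one for \<open>j = 0\<close> meets the positions \<open>\<sigma>\<^sup>t i\<close>, \<open>t < c\<close>.\<close>
  have u_pos: "u (False, s) ((\<sigma> ^^ t) i) = (if s = t then weight s i else 0)"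
    if "s < c" "t < c" for s t
  proof -
    have "n > 0" using k \<open>0 < k\<close> by (cases n) auto
    have "act (z ^ (c * j + s)) (basis_vec i) ((\<sigma> ^^ t) i) =
        (if j = 0 then if s = t then weight s i else 0 else 0)" if "j < n" for j
    proof -
      have "c * j + s < c * j + c" using \<open>s < c\<close> by simp
      also have "\<dots> = c * Suc j" by simp
      also have "\<dots> \<le> k" unfolding k using that by (intro mult_le_mono2) simp
      finally have "c * j + s < k" .
      then have "(\<sigma> ^^ t) i = (\<sigma> ^^ (c * j + s)) i \<longleftrightarrow> t = c * j + s"
        using inj_onD[OF inj, of t "c * j + s"] \<open>t < c\<close> \<open>c < k\<close> by auto
      moreover have "t = c * j + s \<longleftrightarrow> j = 0 \<and> s = t"
        using \<open>t < c\<close> by (cases j) auto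
      ultimately show ?thesis
        using i by (auto simp: act_power_basis_vec funpow_less)
    qed
    then have "u (False, s) ((\<sigma> ^^ t) i) =
        (\<Sum>j<n. if j = 0 then if s = t then weight s i else 0 else 0)"
      unfolding u_def prod.case if_False by (intro sum.cong) auto
    then show ?thesis
      using \<open>n > 0\<close> by simp
  qed
  have "card (UNIV \<times> {..<c} :: (bool \<times> nat) set) * d \<le> card Y * c"
  proof (rule eigenvectors_le[OF Y(1,3), where u = u and b = b and pos = pos])
    fix l q assume "l \<in> (UNIV :: bool set) \<times> {..<c}" and q: "q < d"
    then obtain second t where l: "l = (second, t)" "t < c" by auto
    show "act (z ^ c) (u l) q = b * u l q"
    proof (cases second)
      case True
      then show ?thesis
        using act_cycle[OF i'(1) cyc' q, of t] q by (simp add: l u_def act_power_power b_def)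
    next
      case False
      let ?g = "\<lambda>j. (1 / b) ^ j * act (z ^ (c * j + t)) (basis_vec i) q"
      have "act (z ^ c) (u l) q =
          (\<Sum>j<n. (1 / b) ^ j * act (z ^ c) (act (z ^ (c * j + t)) (basis_vec i)) q)"
        using False by (simp add: l u_def act_sum_vec act_scale_vec)
      also have "\<dots> = (\<Sum>j<n. b * ?g (Suc j))"
        using q \<open>b \<noteq> 0\<close> by (intro sum.cong refl) (simp add: act_power_power add.assoc)
      also have "\<dots> = b * (\<Sum>j<n. ?g (Suc j))"
        by (simp only: sum_distrib_left)
      also have "(\<Sum>j<n. ?g (Suc j)) = (\<Sum>j<n. ?g j)"
      proof -
        \<comment> \<open>Shifting the sum by one replaces its first term by one that agrees with it, since \<open>b\<^sup>n = a\<close>.\<close>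
        have "?g n = ?g 0"
          using q \<open>a \<noteq> 0\<close> by (simp add: power_one_over bn act_k flip: k)
        then show ?thesis
          using sum.lessThan_Suc_shift[of ?g n] by simp
      qed
      finally show ?thesis
        using False by (simp add: l u_def)
    qed
  next
    fix l assume "l \<in> (UNIV :: bool set) \<times> {..<c}"
    then obtain x t where "l = (x, t)" "t < c" by auto
    then show "pos l < d" "u l (pos l) \<noteq> 0"
      using i i' u_pos[of t t] by (cases x; simp add: pos_def u_True funpow_less weight_neq_zero)+
  next
    fix l l' assume "l \<in> (UNIV :: bool set) \<times> {..<c}" "l' \<in> (UNIV :: bool set) \<times> {..<c}" "l \<noteq> l'"
    then obtain x t x' t' where l: "l = (x, t)" "t < c" "l' = (x', t')" "t' < c" "l \<noteq> l'"
      by auto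
    have u_False: "u (False, t) ((\<sigma> ^^ s) i') = 0" for s t
      using i i' disj[symmetric] by (simp add: u_def act_power_basis_vec funpow_less)
    show "u l (pos l') = 0"
      using l i i' u_pos[of t t'] disj u_False inj_onD[OF inj', of t t']
      by (cases x; cases x') (auto simp: pos_def u_True funpow_less)
  qed (use \<open>0 < c\<close> in auto)
  then have "(2 * d) * c \<le> card Y * c"
    by (simp add: card_cartesian_product mult_ac)
  then have "2 * d \<le> card Y"
    using \<open>0 < c\<close> by simp
  then have "2 * d * k \<le> card Y * dim (adjoin z)"
    using k_le by (rule mult_le_mono)
  then have "d * (2 * k) \<le> d * d"
    using Y(2) degree by (simp add: power2_eq_square mult_ac)
  with i large show False by simp
qed

end

section \<open>Splitting representations are spanning\<close>

text \<open>
  An isomorphism \<open>D \<otimes>\<^sub>F K \<cong> M\<^sub>d(K)\<close> is used through the surjection that it induces on the monoid ring of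
  words. Conjugating this surjection by an invertible matrix gives another one
  (lemma \<open>conjugate\<close>).
\<close>

locale split_word_hom = finite_dim_division_algebra \<iota>\<^sub>D + K: field_hom \<iota>\<^sub>K
  for \<iota>\<^sub>D :: "'f::field \<Rightarrow> 'd::division_ring" and \<iota>\<^sub>K :: "'f \<Rightarrow> 'k::field" +
  fixes d :: nat and \<Theta> :: "('d, 'k) tensor_word \<Rightarrow> 'k mat"
  assumes degree: "dim UNIV = d\<^sup>2"
    and word_carrier: "\<Theta> w \<in> carrier_mat d d"
    and word_add: "\<Theta> (v + w) = \<Theta> v + \<Theta> w"
    and word_hom_mult: "\<Theta> (v * w) = \<Theta> v * \<Theta> w"
    and word_relation: "w \<in> tensor_relations \<iota>\<^sub>D \<iota>\<^sub>K \<Longrightarrow> \<Theta> w = 0\<^sub>m d d"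
    and word_scalar: "\<Theta> (word 1 c) = c \<cdot>\<^sub>m 1\<^sub>m d"
    and word_surj: "E \<in> carrier_mat d d \<Longrightarrow> \<exists>w. \<Theta> w = E"
begin

lemma word_diff: "\<Theta> (v - w) = \<Theta> v - \<Theta> w"
proof -
  have "\<Theta> v = \<Theta> (v - w) + \<Theta> w"
    using word_add[of "v - w" w] by simp
  then show ?thesis
    using word_carrier[of "v - w"] word_carrier[of w] by (intro eq_matI) auto
qed

lemma word_entry: 
  assumes "p < d" "q < d"
  shows "\<Theta> (word x c) $$ (p, q) = c * \<Theta> (word x 1) $$ (p, q)"
proof -
  have "\<Theta> (word x c) = \<Theta> (word x 1) * (c \<cdot>\<^sub>m 1\<^sub>m d)"
    unfolding word_scalar[symmetric] word_hom_mult[symmetric] by (simp add: word_mult)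
  also have "\<dots> = c \<cdot>\<^sub>m \<Theta> (word x 1)"
    using word_carrier[of "word x 1"]
    by (simp add: mult_smult_distrib[OF word_carrier one_carrier_mat])
  finally show ?thesis
    using assms word_carrier[of "word x 1"] by simp
qed

text \<open>
  Words are additively generated by the symbols \<open>x \<otimes> c\<close>, and \<open>x \<otimes> c\<close> is mapped to \<open>c\<close> times the image
  of \<open>x \<otimes> 1\<close>.
\<close>

lemma word_span:
  "\<exists>S c. finite S \<and> (\<forall>p<d. \<forall>q<d. \<Theta> w $$ (p, q) = (\<Sum>x\<in>S. c x * \<Theta> (word x 1) $$ (p, q)))"
    (is "\<exists>S c. ?P w S c")
proof (induction w rule: frag_induction[OF subset_UNIV])
  case 1
  have "\<Theta> (0 :: ('d, 'k) tensor_word) = 0\<^sub>m d d"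
    using word_diff[of 0 0] word_carrier[of 0] by simp
  then have "?P 0 {} (\<lambda>_. 0)"
    by simp
  then show ?case by (intro exI)
next
  case (2 s)
  obtain x c where s: "s = Sym x c" by (cases s)
  have "?P (frag_of s) {x} (\<lambda>_. c)"
    using word_entry[of _ _ x c] by (simp add: s)
  then show ?case by (intro exI)
next
  case (3 v w)
  obtain S c where v: "?P v S c"
    using 3(1) by (elim exE)
  obtain S' c' where w: "?P w S' c'"
    using 3(2) by (elim exE)
  have S: "finite S" "finite S'"
    using v w by simp_all
  define e where "e x = (if x \<in> S then c x else 0) - (if x \<in> S' then c' x else 0)" for x
  \<comment> \<open>Extending the coefficients by zero brings both combinations to the common index set.\<close>
  have extend: "(\<Sum>x\<in>S \<union> S'. (if x \<in> U then f x else 0) * h x) = (\<Sum>x\<in>U. f x * h x)"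
    if "U \<subseteq> S \<union> S'" for U and f h :: "'d \<Rightarrow> 'k"
    by (rule sum.mono_neutral_cong_right) (use S that in auto)
  have "?P (v - w) (S \<union> S') e"
    using S word_carrier[of v] word_carrier[of w]
    by (auto simp: word_diff v w e_def left_diff_distrib sum_subtractf extend)
  then show ?case by (intro exI)
qed

lemma spanning_representation_words:
  "spanning_representation \<iota>\<^sub>D \<iota>\<^sub>K d (\<lambda>x. \<Theta> (word x 1))"
proof unfold_locales
  fix x y :: 'd
  have "word (x + y) 1 - word x 1 - word y 1 \<in> tensor_relations \<iota>\<^sub>D \<iota>\<^sub>K"
    unfolding tensor_relations_def by blast
  from word_relation[OF this]
  have "\<Theta> (word (x + y) 1) - \<Theta> (word x 1) - \<Theta> (word y 1) = 0\<^sub>m d d"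
    by (simp add: word_diff)
  then have *: "(\<Theta> (word (x + y) 1) - \<Theta> (word x 1) - \<Theta> (word y 1)) $$ (p, q) = 0"
    if "p < d" "q < d" for p q
    using that by simp
  show "\<Theta> (word (x + y) 1) = \<Theta> (word x 1) + \<Theta> (word y 1)"
    using * word_carrier[of "word (x + y) 1"] word_carrier[of "word x 1"] word_carrier[of "word y 1"]
    by (intro eq_matI) (auto simp: algebra_simps)
  show "\<Theta> (word (x * y) 1) = \<Theta> (word x 1) * \<Theta> (word y 1)"
    by (simp add: word_mult flip: word_hom_mult)
next
  fix t
  have "word (\<iota>\<^sub>D t * 1) 1 - word 1 (\<iota>\<^sub>K t * 1) \<in> tensor_relations \<iota>\<^sub>D \<iota>\<^sub>K"
    unfolding tensor_relations_def by blast
  from word_relation[OF this]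
  have "\<Theta> (word (\<iota>\<^sub>D t) 1) - \<iota>\<^sub>K t \<cdot>\<^sub>m 1\<^sub>m d = 0\<^sub>m d d"
    by (simp add: word_diff word_scalar)
  then have *: "(\<Theta> (word (\<iota>\<^sub>D t) 1) - \<iota>\<^sub>K t \<cdot>\<^sub>m 1\<^sub>m d) $$ (p, q) = 0" if "p < d" "q < d" for p q
    using that by simp
  show "\<Theta> (word (\<iota>\<^sub>D t) 1) = \<iota>\<^sub>K t \<cdot>\<^sub>m 1\<^sub>m d"
    using * word_carrier[of "word (\<iota>\<^sub>D t) 1"] by (intro eq_matI) auto
next
  fix E :: "'k mat" assume "E \<in> carrier_mat d d"
  with word_surj obtain w where "\<Theta> w = E" by blast
  with word_span[of w]
  show "\<exists>S c. finite S \<and> (\<forall>p<d. \<forall>q<d. E $$ (p, q) = (\<Sum>x\<in>S. c x * \<Theta> (word x 1) $$ (p, q)))"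
    by blast
qed (rule word_carrier degree)+

lemma conjugate:
  assumes g: "g \<in> carrier_mat d d" "h \<in> carrier_mat d d" "g * h = 1\<^sub>m d" "h * g = 1\<^sub>m d"
  shows "split_word_hom \<iota>\<^sub>D \<iota>\<^sub>K d (\<lambda>w. g * \<Theta> w * h)"
proof unfold_locales
  fix v w
  note c = word_carrier[of v] word_carrier[of w] g(1,2)
  show "g * \<Theta> (v + w) * h = g * \<Theta> v * h + g * \<Theta> w * h"
    unfolding word_add using c
    by (simp add: mult_add_distrib_mat[of _ d d _ d] add_mult_distrib_mat[of _ d d _ _ d])
  have "g * \<Theta> v * h * (g * \<Theta> w * h) = g * \<Theta> v * (h * g) * \<Theta> w * h"
    using c by (simp add: assoc_mult_mat[of _ d d _ d _ d])
  then show "g * \<Theta> (v * w) * h = g * \<Theta> v * h * (g * \<Theta> w * h)"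
    unfolding word_hom_mult g(4) using c by (simp add: assoc_mult_mat[of _ d d _ d _ d])
next
  fix c
  show "g * \<Theta> (word 1 c) * h = c \<cdot>\<^sub>m 1\<^sub>m d"
    unfolding word_scalar using g
    by (simp add: mult_smult_distrib[OF g(1) one_carrier_mat] mult_smult_assoc_mat[OF g(1,2)])
next
  fix E :: "'k mat" assume E: "E \<in> carrier_mat d d"
  then obtain w where w: "\<Theta> w = h * E * g"
    using word_surj[of "h * E * g"] g by auto
  have "g * (h * E * g) * h = g * h * E * (g * h)"
    using g(1,2) E by (simp add: assoc_mult_mat[of _ d d _ d _ d])
  also have "\<dots> = E"
    unfolding g(3) using E by simp
  finally have "g * \<Theta> w * h = E"
    by (simp only: w)
  then show "\<exists>w. g * \<Theta> w * h = E" ..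
next
  show "dim UNIV = d\<^sup>2"
    by (rule degree)
qed (use g word_carrier in \<open>auto simp: word_relation\<close>)

end

text \<open>
  The surjection is the composition of the quotient map with \<open>\<Phi>\<close>; it kills the defining relations of
  the tensor product.
\<close>

lemma splitting_isomorphism_word_hom:
  fixes \<iota>\<^sub>D :: "'f::field \<Rightarrow> 'd::division_ring" and \<iota>\<^sub>K :: "'f \<Rightarrow> 'k::field"
  assumes D: "division_algebra_with_center \<iota>\<^sub>D" "has_degree \<iota>\<^sub>D d" "0 < d"
    and K: "field_hom \<iota>\<^sub>K"
    and \<Phi>: "splitting_isomorphism \<iota>\<^sub>D \<iota>\<^sub>K d \<Phi>"
  shows "split_word_hom \<iota>\<^sub>D \<iota>\<^sub>K d
    (\<lambda>w. \<Phi> (tensor_ideal \<iota>\<^sub>D \<iota>\<^sub>K +>\<^bsub>word_ring\<^esub> w))"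
proof -
  interpret K: field_hom \<iota>\<^sub>K by fact
  interpret R: ring "word_ring :: ('d, 'k) tensor_word ring"
    by (rule word_ring_ring)
  let ?R = "word_ring :: ('d, 'k) tensor_word ring"
  let ?I = "tensor_ideal \<iota>\<^sub>D \<iota>\<^sub>K"
  let ?M = "ring_mat TYPE('k) d ()"
  let ?\<Theta> = "\<lambda>w. \<Phi> (?I +>\<^bsub>?R\<^esub> w)"
  have rels: "tensor_relations \<iota>\<^sub>D \<iota>\<^sub>K \<subseteq> carrier ?R"
    by (simp add: word_ring_def)
  interpret I: ideal ?I ?R
    unfolding tensor_ideal_def by (rule R.genideal_ideal[OF rels])
  have iso: "\<Phi> \<in> Ring.ring_hom (?R Quot ?I) ?M" "bij_betw \<Phi> (carrier (?R Quot ?I)) (carrier ?M)"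
    using \<Phi> by (simp_all add: splitting_isomorphism_def ring_iso_def tensor_ring_def)
  have hom: "?\<Theta> \<in> Ring.ring_hom ?R ?M"
    using ring_hom_trans[OF I.rcos_ring_hom iso(1)] by (simp add: comp_def)
  have car: "?\<Theta> w \<in> carrier_mat d d" for w
    using ring_hom_closed[OF hom] by (simp add: word_ring_def ring_mat_simps)
  have add: "?\<Theta> (v + w) = ?\<Theta> v + ?\<Theta> w" for v w
    using ring_hom_add[OF hom, of v w] by (simp add: word_ring_def ring_mat_simps)
  have mult: "?\<Theta> (v * w) = ?\<Theta> v * ?\<Theta> w" for v w
    using ring_hom_mult[OF hom, of v w] by (simp add: word_ring_def ring_mat_simps)
  have zero: "?\<Theta> 0 = 0\<^sub>m d d"
  proof (rule eq_matI)
    fix i j assume "i < dim_row (0\<^sub>m d d)" "j < dim_col (0\<^sub>m d d)"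
    then show "?\<Theta> 0 $$ (i, j) = 0\<^sub>m d d $$ (i, j)"
      using add[of 0 0] car[of 0] by (metis add_cancel_left_left add.right_neutral
          carrier_matD index_add_mat(1) index_zero_mat)
  qed (use car in auto)
  have coset: "?I +>\<^bsub>?R\<^esub> w = ?I" if "w \<in> ?I" for w
    using I.a_rcos_const that by simp
  have rel: "?\<Theta> w = 0\<^sub>m d d" if "w \<in> tensor_relations \<iota>\<^sub>D \<iota>\<^sub>K" for w
  proof -
    have "w \<in> ?I"
      using R.genideal_self[OF rels] that unfolding tensor_ideal_def by blast
    moreover have "0 \<in> ?I"
      using I.zero_closed by (simp add: word_ring_def)
    ultimately show ?thesis
      using zero by (simp add: coset)
  qed
  have scalar: "?\<Theta> (word 1 c) = c \<cdot>\<^sub>m 1\<^sub>m d" for c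
    using \<Phi> by (simp add: splitting_isomorphism_def pure_tensor_def)
  have surj: "\<exists>w. ?\<Theta> w = E" if "E \<in> carrier_mat d d" for E
  proof -
    have "E \<in> \<Phi> ` carrier (?R Quot ?I)"
      using iso(2) that by (simp add: bij_betw_def ring_mat_simps)
    then show ?thesis
      by (auto simp: FactRing_def A_RCOSETS_def')
  qed
  have dim: "vector_space.dim (\<lambda>a x. \<iota>\<^sub>D a * x) UNIV = d\<^sup>2"
    using D(2) by (simp add: has_degree_def)
  have "finite_dim_division_algebra \<iota>\<^sub>D"
  proof (rule finite_dim_division_algebra.intro)
    show "Ring_Hom.ring_hom \<iota>\<^sub>D"
      using D(1) by (simp add: division_algebra_with_center_def)
    show "\<iota>\<^sub>D a * x = x * \<iota>\<^sub>D a" for a x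
      using D(1) unfolding division_algebra_with_center_def by blast
  qed (simp add: dim D(3))
  then interpret finite_dim_division_algebra \<iota>\<^sub>D .
  show ?thesis
    by unfold_locales (rule dim car add mult scalar | erule rel surj)+
qed

section \<open>Cosets of the diagonal group and cycles of their permutations\<close>

lemma GL_inverse:
  assumes "g \<in> carrier (GL TYPE('k::field) d)"
  obtains h where "g \<in> carrier_mat d d" "h \<in> carrier_mat d d" "g * h = 1\<^sub>m d" "h * g = 1\<^sub>m d"
    "inv\<^bsub>GL TYPE('k) d\<^esub> g = h"
proof -
  interpret R: ring "ring_mat TYPE('k) d ()"
    by (rule ring_mat)
  interpret group "GL TYPE('k) d"
    unfolding GL_def by (rule R.units_group)
  have *: "x \<in> carrier_mat d d" if "x \<in> carrier (GL TYPE('k) d)" for x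
    using that R.Units_closed by (auto simp: GL_def units_of_carrier ring_mat_simps)
  show ?thesis
    by (rule that[of "inv\<^bsub>GL TYPE('k) d\<^esub> g"])
       (use *[OF assms] *[OF inv_closed[OF assms]] r_inv[OF assms] l_inv[OF assms]
        in \<open>simp_all add: GL_def units_of_mult units_of_one ring_mat_simps\<close>)
qed

lemma monomial_perm:
  assumes "monomial_mat d A" "j < d"
  shows "monomial_perm d A j < d" "A $$ (monomial_perm d A j, j) \<noteq> 0"
    and "i < d \<Longrightarrow> i \<noteq> monomial_perm d A j \<Longrightarrow> A $$ (i, j) = 0"
proof -
  have ex1: "\<exists>!i. i < d \<and> A $$ (i, j) \<noteq> 0"
    using assms by (simp add: monomial_mat_def)
  have "monomial_perm d A j < d \<and> A $$ (monomial_perm d A j, j) \<noteq> 0"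
    using theI'[OF ex1] assms(2) by (simp add: monomial_perm_def)
  with ex1 show "monomial_perm d A j < d" "A $$ (monomial_perm d A j, j) \<noteq> 0"
    and "i < d \<Longrightarrow> i \<noteq> monomial_perm d A j \<Longrightarrow> A $$ (i, j) = 0"
    by blast+
qed

lemma torus_mult:
  assumes t: "t \<in> torus TYPE('k::field) d" and n: "n \<in> carrier_mat d d"
  shows "i < d \<Longrightarrow> j < d \<Longrightarrow> (t * n) $$ (i, j) = t $$ (i, i) * n $$ (i, j)"
    and "i < d \<Longrightarrow> t $$ (i, i) \<noteq> 0"
proof -
  have "t \<in> carrier (GL TYPE('k) d)"
    using t by (simp add: torus_def)
  then obtain h where h: "t \<in> carrier_mat d d" "h \<in> carrier_mat d d" "t * h = 1\<^sub>m d"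
    by (rule GL_inverse)
  have mult: "(t * m) $$ (i, j) = t $$ (i, i) * m $$ (i, j)"
    if "m \<in> carrier_mat d d" "i < d" "j < d" for m i j
  proof -
    have "(t * m) $$ (i, j) = (\<Sum>p\<in>{0..<d}. t $$ (i, p) * m $$ (p, j))"
      using that h(1) by (simp add: scalar_prod_def)
    also have "\<dots> = (\<Sum>p\<in>{0..<d}. if p = i then t $$ (i, i) * m $$ (i, j) else 0)"
      using t h(1) that by (intro sum.cong) (auto simp: torus_def diagonal_mat_def)
    also have "\<dots> = t $$ (i, i) * m $$ (i, j)"
      using that by simp
    finally show ?thesis .
  qed
  show "i < d \<Longrightarrow> j < d \<Longrightarrow> (t * n) $$ (i, j) = t $$ (i, i) * n $$ (i, j)"
    using mult[OF n] .
  show "t $$ (i, i) \<noteq> 0" if "i < d"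
    using mult[OF h(2) that that] that by (auto simp: h(3))
qed

text \<open>
  Multiplication by an invertible diagonal matrix rescales rows by nonzero factors and so preserves
  the pattern of nonzero entries.
\<close>

lemma torus_coset_pattern:
  assumes X: "X \<in> carrier (monomial_group TYPE('k::field) d Mod torus TYPE('k) d)"
    and A: "A \<in> X"
  obtains n :: "'k::field mat" where "monomial_mat d n" "coset_perm d X = monomial_perm d n"
    and "\<And>i j. i < d \<Longrightarrow> j < d \<Longrightarrow> A $$ (i, j) = 0 \<longleftrightarrow> n $$ (i, j) = 0"
proof -
  obtain n where n: "monomial_mat d n" and X_eq: "X = (\<lambda>t. t * n) ` torus TYPE('k) d"
    using X by (auto simp: carrier_FactGroup r_coset_def monomial_group_def GL_def
        units_of_mult ring_mat_simps)
  have car: "n \<in> carrier_mat d d"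
    using n by (simp add: monomial_mat_def)
  have pattern: "m $$ (i, j) = 0 \<longleftrightarrow> n $$ (i, j) = 0" if "m \<in> X" "i < d" "j < d" for m i j
    using that torus_mult[OF _ car] by (auto simp: X_eq)
  then have "monomial_perm d m = monomial_perm d n" if "m \<in> X" for m
    using that unfolding monomial_perm_def by (intro ext if_cong refl arg_cong[of _ _ The]) auto
  then have "monomial_perm d ` X = (\<lambda>_. monomial_perm d n) ` X"
    by (rule image_cong[OF refl])
  also have "\<dots> = {monomial_perm d n}"
    using A by (rule image_constant)
  finally have perm: "coset_perm d X = monomial_perm d n"
    by (simp add: coset_perm_def)
  show ?thesis
    by (rule that[OF n perm]) (fact pattern[OF A])
qed

lemma cycle_decomp_permutes: "cycle_decomp I p \<Longrightarrow> p permutes I"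
proof (induction rule: cycle_decomp.induct)
  case empty
  show ?case by (rule permutes_id)
next
  case (comp I p cs)
  show ?case
    by (rule permutes_compose; rule permutes_subset) (use comp cycle_permutes in auto)
qed

lemma funpow_eq_on:
  assumes "\<And>x. x \<in> S \<Longrightarrow> f x = g x" "\<And>x. x \<in> S \<Longrightarrow> g x \<in> S" "x \<in> S"
  shows "(f ^^ n) x = (g ^^ n) x \<and> (g ^^ n) x \<in> S"
  using assms by (induction n) auto

lemma on_cycle_permutation:
  assumes "finite S" "p permutes S" "x \<in> S"
  obtains c where "on_cycle p c x" "c \<le> card S"
proof -
  have p: "permutation p"
    using assms permutation_permutes by blast
  let ?c = "least_power p x"
  have inj: "inj_on (\<lambda>t. (p ^^ t) x) {..<?c}"
    using cycle_of_permutation[OF p, of x] by (simp add: distinct_map lessThan_atLeast0)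
  have "(\<lambda>t. (p ^^ t) x) ` {..<?c} \<subseteq> S"
    using permutes_in_image[OF permutes_funpow[OF assms(2)]] assms(3) by blast
  with inj have "card {..<?c} \<le> card S"
    by (rule card_inj_on_le) fact
  then show ?thesis
    using inj least_power_of_permutation[OF p, of x] by (intro that) (simp_all add: on_cycle_def)
qed

lemma on_cycle_cycle_of_list:
  assumes "cycle cs" "cs \<noteq> []"
  shows "on_cycle (cycle_of_list cs) (length cs) (hd cs)"
proof -
  have *: "(cycle_of_list cs ^^ t) (hd cs) = cs ! (t mod length cs)" for t
  proof -
    have "(cycle_of_list cs ^^ t) (hd cs) = map (cycle_of_list cs ^^ t) cs ! 0"
      using assms(2) by (simp add: hd_conv_nth)
    also have "\<dots> = cs ! (t mod length cs)"
      using assms(2) by (simp add: cyclic_rotation[OF assms(1)] nth_rotate)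
    finally show ?thesis .
  qed
  show ?thesis
    using assms by (auto simp: on_cycle_def * inj_on_def nth_eq_iff_index_eq) (simp add: hd_conv_nth)
qed

lemma on_cycle_cong:
  assumes "\<And>t. (\<sigma> ^^ t) i = (p ^^ t) i"
  shows "on_cycle \<sigma> k i \<longleftrightarrow> on_cycle p k i"
  by (simp add: on_cycle_def assms)

text \<open>
  The points outside of the \<open>k\<close>-cycle are permuted among themselves, there are \<open>d - k > 0\<close> of them, and
  any one lies on a cycle of at most that length.
\<close>

lemma features_cycle_two_cycles:
  assumes \<sigma>: "features_cycle d k \<sigma>" and k: "0 < k" "k < d"
  obtains i i' c where "i < d" "on_cycle \<sigma> k i" "i' < d" "on_cycle \<sigma> c i'" "c \<le> d - k"
    "\<And>s t. (\<sigma> ^^ s) i \<noteq> (\<sigma> ^^ t) i'"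
proof -
  obtain cs p where cs: "cycle cs" "length cs = k" "set cs \<subseteq> {..<d}"
    and p: "p permutes ({..<d} - set cs)" and \<sigma>_eq: "\<sigma> = cycle_of_list cs \<circ> p"
    using \<sigma> cycle_decomp_permutes unfolding features_cycle_def by blast
  let ?S = "{..<d} - set cs"
  have card: "card ?S = d - k"
    using cs by (subst card_Diff_subset) (simp_all add: distinct_card)
  with k have "?S \<noteq> {}"
    by (metis card.empty zero_less_diff less_irrefl)
  then obtain i' where i': "i' \<in> ?S" by blast
  obtain c where c: "on_cycle p c i'" "c \<le> card ?S"
    by (rule on_cycle_permutation[OF _ p i']) auto
  have "\<sigma> x = p x" if "x \<in> ?S" for x
    using id_outside_supp[of "p x" cs] permutes_in_image[OF p, of x] that by (simp add: \<sigma>_eq)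
  then have i'_orbit: "(\<sigma> ^^ t) i' = (p ^^ t) i' \<and> (p ^^ t) i' \<in> ?S" for t
    by (rule funpow_eq_on) (use i' permutes_in_image[OF p] in simp_all)
  have "cs \<noteq> []" using cs k by auto
  then have hd: "hd cs \<in> set cs" by simp
  have "\<sigma> x = cycle_of_list cs x" if "x \<in> set cs" for x
    using permutes_not_in[OF p, of x] that by (simp add: \<sigma>_eq)
  then have i_orbit: "(\<sigma> ^^ t) (hd cs) = (cycle_of_list cs ^^ t) (hd cs) \<and>
      (cycle_of_list cs ^^ t) (hd cs) \<in> set cs" for t
    by (rule funpow_eq_on) (use hd permutes_in_image[OF cycle_permutes[of cs]] in simp_all)
  show ?thesis
  proof (rule that)
    show "hd cs < d" "i' < d"
      using hd i' cs(3) by auto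
    show "on_cycle \<sigma> k (hd cs)"
      using on_cycle_cycle_of_list[OF cs(1) \<open>cs \<noteq> []\<close>] cs(2) i_orbit
      by (subst on_cycle_cong[of _ _ "cycle_of_list cs"]) auto
    show "on_cycle \<sigma> c i'"
      using c(1) i'_orbit by (subst on_cycle_cong[of _ _ p]) auto
    show "c \<le> d - k"
      using c(2) card by simp
    show "(\<sigma> ^^ s) (hd cs) \<noteq> (\<sigma> ^^ t) i'" for s t
      using i_orbit[of s] i'_orbit[of t] by auto
  qed
qed

theorem theorem3p10:
  fixes \<iota>\<^sub>D :: "'f::field \<Rightarrow> 'd::division_ring"
    and \<iota>\<^sub>K :: "'f \<Rightarrow> 'k::field"
    and d k :: nat
    and \<phi> :: "'d \<Rightarrow> 'k mat"
    and X :: "'k mat set"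
    and z :: 'd
    and g :: "'k mat"
  assumes "division_algebra_with_center \<iota>\<^sub>D"
    and "has_degree \<iota>\<^sub>D d" and "d > 2"
    and "splitting_field \<iota>\<^sub>D \<iota>\<^sub>K d"
    and "splitting_representation \<iota>\<^sub>D \<iota>\<^sub>K d \<phi>"
    and "X \<in> carrier (monomial_group TYPE('k) d Mod torus TYPE('k) d)"
    and "features_cycle d k (coset_perm d X)"
    and "real d / 2 < real k" and "k < d"
    and "z \<noteq> 0"
    and "g \<in> carrier (GL TYPE('k) d)"
  shows "g \<otimes>\<^bsub>GL TYPE('k) d\<^esub> \<phi> z \<otimes>\<^bsub>GL TYPE('k) d\<^esub> inv\<^bsub>GL TYPE('k) d\<^esub> g \<notin> X"
proof
  assume in_X: "g \<otimes>\<^bsub>GL TYPE('k) d\<^esub> \<phi> z \<otimes>\<^bsub>GL TYPE('k) d\<^esub> inv\<^bsub>GL TYPE('k) d\<^esub> g \<in> X"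
  obtain h where h: "g \<in> carrier_mat d d" "h \<in> carrier_mat d d" "g * h = 1\<^sub>m d" "h * g = 1\<^sub>m d"
    and inv: "inv\<^bsub>GL TYPE('k) d\<^esub> g = h"
    using assms(11) by (rule GL_inverse)
  define \<psi> where "\<psi> x = g * \<phi> x * h" for x
  have in_X: "\<psi> z \<in> X"
    using in_X unfolding inv by (simp add: \<psi>_def GL_def units_of_mult ring_mat_simps)
  obtain \<Phi> where \<Phi>: "splitting_isomorphism \<iota>\<^sub>D \<iota>\<^sub>K d \<Phi>"
    and \<phi>: "\<And>x. \<phi> x = \<Phi> (pure_tensor \<iota>\<^sub>D \<iota>\<^sub>K x 1)"
    using assms(5) unfolding splitting_representation_def by blast
  have "field_hom \<iota>\<^sub>K" "0 < d"
    using assms(3,4) by (simp_all add: splitting_field_def)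
  from splitting_isomorphism_word_hom[OF assms(1,2) this(2,1) \<Phi>]
  have "split_word_hom \<iota>\<^sub>D \<iota>\<^sub>K d (\<lambda>w. \<Phi> (tensor_ideal \<iota>\<^sub>D \<iota>\<^sub>K +>\<^bsub>word_ring\<^esub> w))" .
  from split_word_hom.spanning_representation_words[OF split_word_hom.conjugate[OF this h]]
  have "spanning_representation \<iota>\<^sub>D \<iota>\<^sub>K d \<psi>"
    unfolding \<psi>_def[abs_def] \<phi> pure_tensor_def .
  then interpret spanning_representation \<iota>\<^sub>D \<iota>\<^sub>K d \<psi> .
  obtain n :: "'k mat" where n: "monomial_mat d n" and \<sigma>: "coset_perm d X = monomial_perm d n"
    and pattern: "\<And>i j. i < d \<Longrightarrow> j < d \<Longrightarrow> \<psi> z $$ (i, j) = 0 \<longleftrightarrow> n $$ (i, j) = 0"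
    using torus_coset_pattern[OF assms(6) in_X] by blast
  let ?\<sigma> = "monomial_perm d n"
  interpret monomial_element \<iota>\<^sub>D \<iota>\<^sub>K d \<psi> z ?\<sigma> "\<lambda>j. \<psi> z $$ (?\<sigma> j, j)"
    by unfold_locales (use monomial_perm[OF n] pattern assms(10) in auto)
  have k: "0 < k" "d < 2 * k"
    using assms(8) by linarith+
  obtain i i' c where "i < d" "on_cycle ?\<sigma> k i" "i' < d" "on_cycle ?\<sigma> c i'" "c \<le> d - k"
    and disj: "\<And>s t. (?\<sigma> ^^ s) i \<noteq> (?\<sigma> ^^ t) i'"
    using features_cycle_two_cycles[OF assms(7) k(1) assms(9)] unfolding \<sigma> by metis
  moreover from this k(2) have "c < k" by linarith
  ultimately show False
    using no_second_cycle[of i k i' c] k(2) by simp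
qed

end
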